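(* Let $\lambda>0$, $c>0$, $p,q\ge 0$ with $p+q\le 1$, and let $(X(t),Y(t))$ be the planar random motion defined in the context. For every $t>0$, the measure $A\mapsto \mathbb{P}\big(X(t)+Y(t)=ct,\ X(t)-Y(t)\in A\big)$ on Borel subsets $A$ of $(-ct,ct)$ has the density $$f(\eta,t)=\frac{e^{-\lambda t}}{4c}\left[\frac{\lambda(p+q)}{2}\,I_0\left(\frac{\lambda}{c}\sqrt{pq}\sqrt{c^2t^2-\eta^2}\right)+\frac{\partial}{\partial t}I_0\left(\frac{\lambda}{c}\sqrt{pq}\sqrt{c^2t^2-\eta^2}\right)\right],\qquad |\eta|<ct,$$ where $I_0$ is the modified Bessel function of the first kind of order $0$.
   Context: Model. Let $d_j=(\cos(\pi j/2),\sin(\pi j/2))$, with index $j$ taken modulo 4. Let $N(t)$ be a homogeneous Poisson process of rate $\lambda$. The direction process $D(t)$ takes values in $\{d_0,d_1,d_2,d_3\}$; $D(0)$ is uniformly distributed and independent of $N$; $D$ is constant between Poisson events; at each Poisson event, independently of everything else, $D$ jumps from its current value $d_j$ to $d_{j+1}$ with probability $p$ (counterclockwise turn), to $d_{j-1}$ with probability $q$ (clockwise turn), and to $d_{j+2}$ with probability $1-p-q$ (reflection). The motion starts at the origin and has speed $c$: $(X(t),Y(t))=c\int_0^t D(\tau)\,d\tau$. *)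

theory Defs
  imports "HOL-Probability.Probability"
begin

definition bessel_I :: "nat \<Rightarrow> real \<Rightarrow> real" where
  "bessel_I n x = (\<Sum>k. (x / 2) ^ (2 * k + n) / (fact k * fact (k + n)))"

definition dir :: "int \<Rightarrow> real \<times> real" where
  "dir j = (cos (pi * of_int j / 2), sin (pi * of_int j / 2))"

(* Only times t >= 0 are constrained. Path regularity is required on all of space M,
   not merely almost surely, because M need not be complete. The subtractions on nat
   below do not truncate, since paths are nondecreasing. *)
locale poisson_process = prob_space +
  fixes rate :: real and N :: "real \<Rightarrow> 'a \<Rightarrow> nat"
  assumes N_measurable: "\<And>t. 0 \<le> t \<Longrightarrow> random_variable (count_space UNIV) (N t)"
    and N_zero: "\<And>\<omega>. \<omega> \<in> space M \<Longrightarrow> N 0 \<omega> = 0"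
    and N_mono: "\<And>\<omega> s t. \<omega> \<in> space M \<Longrightarrow> 0 \<le> s \<Longrightarrow> s \<le> t \<Longrightarrow> N s \<omega> \<le> N t \<omega>"
    and N_right_continuous:
      "\<And>\<omega> t. \<omega> \<in> space M \<Longrightarrow> 0 \<le> t \<Longrightarrow> continuous (at_right t) (\<lambda>s. N s \<omega>)"
    and independent_increments:
      "\<And>(\<tau> :: nat \<Rightarrow> real) n. 0 \<le> \<tau> 0 \<Longrightarrow> incseq \<tau> \<Longrightarrow>
         indep_vars (\<lambda>_. count_space UNIV) (\<lambda>i \<omega>. N (\<tau> (Suc i)) \<omega> - N (\<tau> i) \<omega>) {..<n}"
    and poisson_increments:
      "\<And>s t. 0 \<le> s \<Longrightarrow> s < t \<Longrightarrow>
         distr M (count_space UNIV) (\<lambda>\<omega>. N t \<omega> - N s \<omega>) = measure_pmf (poisson_pmf (rate * (t - s)))"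

(* J is the index of the initial direction and T k is the signed number of quarter turns made
   at the (k+1)-st Poisson event: 1 is counterclockwise, -1 is clockwise, 2 is a reflection. *)
locale orthogonal_motion = poisson_process +
  fixes p q :: real and J :: "'a \<Rightarrow> int" and T :: "nat \<Rightarrow> 'a \<Rightarrow> int"
  assumes J_uniform: "\<And>j. j \<in> {0..3} \<Longrightarrow> prob {\<omega> \<in> space M. J \<omega> = j} = 1 / 4"
    and T_counterclockwise: "\<And>k. prob {\<omega> \<in> space M. T k \<omega> = 1} = p"
    and T_clockwise: "\<And>k. prob {\<omega> \<in> space M. T k \<omega> = -1} = q"
    and T_reflection: "\<And>k. prob {\<omega> \<in> space M. T k \<omega> = 2} = 1 - p - q"
    and J_T_independent:
      "indep_vars (\<lambda>_. count_space UNIV) (\<lambda>i. case i of 0 \<Rightarrow> J | Suc k \<Rightarrow> T k) UNIV"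
    (* the whole process N is independent of the whole family (J, T 0, T 1, ...) *)
    and N_J_T_independent:
      "indep_set
         (sets (vimage_algebra (space M) (\<lambda>\<omega>. \<lambda>t\<in>{0..}. N t \<omega>)
            (PiM {0..} (\<lambda>_. count_space UNIV))))
         (sets (vimage_algebra (space M) (\<lambda>\<omega> i. case i of 0 \<Rightarrow> J \<omega> | Suc k \<Rightarrow> T k \<omega>)
            (PiM UNIV (\<lambda>_. count_space UNIV))))"

definition direction ::
    "(real \<Rightarrow> 'a \<Rightarrow> nat) \<Rightarrow> ('a \<Rightarrow> int) \<Rightarrow> (nat \<Rightarrow> 'a \<Rightarrow> int) \<Rightarrow> real \<Rightarrow> 'a \<Rightarrow> real \<times> real" where
  "direction N J T t \<omega> = dir (J \<omega> + (\<Sum>k<N t \<omega>. T k \<omega>))"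

definition position ::
    "real \<Rightarrow> (real \<Rightarrow> 'a \<Rightarrow> nat) \<Rightarrow> ('a \<Rightarrow> int) \<Rightarrow> (nat \<Rightarrow> 'a \<Rightarrow> int) \<Rightarrow> real \<Rightarrow> 'a \<Rightarrow> real \<times> real" where
  "position c N J T t \<omega> = c *\<^sub>R integral {0..t} (\<lambda>\<tau>. direction N J T \<tau> \<omega>)"

definition edge_density :: "real \<Rightarrow> real \<Rightarrow> real \<Rightarrow> real \<Rightarrow> real \<Rightarrow> real \<Rightarrow> real" where
  "edge_density rate c p q \<eta> t =
     exp (- rate * t) / (4 * c) *
       (rate * (p + q) / 2 * bessel_I 0 (rate / c * sqrt (p * q) * sqrt (c\<^sup>2 * t\<^sup>2 - \<eta>\<^sup>2))
        + deriv (\<lambda>s. bessel_I 0 (rate / c * sqrt (p * q) * sqrt (c\<^sup>2 * s\<^sup>2 - \<eta>\<^sup>2))) t)"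

end

(*
  On the edge X + Y = ct the direction alternates between d_0 and d_1, so up to null sets the
  event is determined by the initial index and the first N(t) turns, and X - Y = +-c(2V - t),
  where V is the time in [0,t] during which N is even.  The turns are independent of N, so only
  the joint law of (N(t), V) is needed.  Its moments E[V^k; N(t) = n] are computed by induction
  on k from V_t^(k+1) = (k+1) * int_0^t V_s^k 1[N_s even] ds and independence of increments; they
  are the moments of a Beta density, and moments determine a measure on [0,t].  In the sum of
  the Beta densities odd n give the Bessel series and even n >= 2 its derivative; n = 0 contributes
  only the end points.
*)

theory Submission
  imports Defs
begin

section \<open>Counting processes with right-continuous paths\<close>

text \<open>Two obstacles shape the proof. The axioms give independence only for finitely many
  increments, while \<open>even_time\<close> depends on the whole path; it is therefore replaced by
  Riemann sums, functions of increments up to \<open>s\<close>, and the independence of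
  \<open>N t - N s\<close> passes to the limit. Moreover the turns are independent of the
  sigma-algebra generated by \<open>N\<close> alone, so the even time must be measurable for that
  smaller sigma-algebra. Hence \<open>counting_process\<close> collects what the path arguments use,
  free of probability, and is instantiated both with \<open>M\<close> and with the sigma-algebra
  generated by \<open>N\<close>.

  The Beta law has a known source: given \<open>Suc n\<close> events, the \<open>n + 2\<close>
  spacings of \<open>[0, t]\<close> have a symmetric Dirichlet law, and the even time adds up
  \<open>Suc n div 2 + 1\<close> of them. Arrival times are never constructed; moments replace them.

  The null sets are genuine: the axioms allow single paths that jump by two, or exactly at time
  \<open>t\<close>. Then \<open>N t\<close> counts a turn whose resulting direction never enters the
  integral up to \<open>t\<close>.\<close>

locale counting_process =
  fixes G :: "'a measure" and N :: "real \<Rightarrow> 'a \<Rightarrow> nat"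
  assumes measurable_N: "0 \<le> t \<Longrightarrow> N t \<in> G \<rightarrow>\<^sub>M count_space UNIV"
    and mono_N: "\<omega> \<in> space G \<Longrightarrow> 0 \<le> s \<Longrightarrow> s \<le> t \<Longrightarrow> N s \<omega> \<le> N t \<omega>"
    and right_continuous_N: "\<omega> \<in> space G \<Longrightarrow> 0 \<le> t \<Longrightarrow> continuous (at_right t) (\<lambda>s. N s \<omega>)"
begin

lemma eventually_at_right_N:
  assumes "\<omega> \<in> space G" "0 \<le> t"
  shows "\<forall>\<^sub>F s in at_right t. N s \<omega> = N t \<omega>"
  using right_continuous_N[OF assms] by (simp add: continuous_within tendsto_discrete)

lemma constant_right_N:
  assumes "\<omega> \<in> space G" "0 \<le> t"
  shows "\<exists>e>t. \<forall>s. t \<le> s \<and> s < e \<longrightarrow> N s \<omega> = N t \<omega>"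
proof -
  from eventually_at_right_N[OF assms] obtain e where "t < e" "\<And>s. t < s \<Longrightarrow> s < e \<Longrightarrow> N s \<omega> = N t \<omega>"
    by (auto simp: eventually_at_right_field)
  then show ?thesis by (intro exI[of _ e]) (auto simp: order_le_less)
qed

text \<open>The set \<open>S\<close> consists of the passage times of \<open>N\<close> above each
  level below \<open>N t \<omega>\<close>, that is, of the jump times. Its finiteness is what the
  fundamental theorem of calculus with exceptional points asks for.\<close>

lemma locally_constant_N:
  assumes \<omega>: "\<omega> \<in> space G"
  obtains S where "finite S"
    "\<And>u. u \<in> {0<..<t} - S \<Longrightarrow> \<forall>\<^sub>F s in at u. N s \<omega> = N u \<omega>"
proof
  define S where "S = (\<lambda>k. Inf {u. 0 \<le> u \<and> k < N u \<omega>}) ` {..<N t \<omega>}"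
  show "finite S" by (simp add: S_def)
  fix u assume u: "u \<in> {0<..<t} - S"
  then have "0 < u" "u < t" "u \<notin> S" by auto
  obtain l where l: "0 \<le> l" "l < u" "\<And>s. l < s \<Longrightarrow> s \<le> u \<Longrightarrow> N s \<omega> = N u \<omega>"
  proof (cases "N u \<omega>")
    case 0
    then show ?thesis using that[of 0] mono_N[OF \<omega>, of _ u] \<open>0 < u\<close> by fastforce
  next
    case (Suc k)
    \<comment> \<open>Level \<open>k\<close> is passed strictly before \<open>u\<close>, since
      \<open>u\<close> is not itself the passage time. From some \<open>l < u\<close> beyond that
      passage up to \<open>u\<close>, the value is squeezed between \<open>Suc k\<close> and
      \<open>N u \<omega>\<close>.\<close>
    let ?A = "{u. 0 \<le> u \<and> k < N u \<omega>}"
    have "k < N t \<omega>" using mono_N[OF \<omega>, of u t] Suc \<open>0 < u\<close> \<open>u < t\<close> by auto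
    then have "Inf ?A \<noteq> u" using \<open>u \<notin> S\<close> by (auto simp: S_def)
    moreover have "bdd_below ?A" by (auto intro: bdd_belowI[of _ 0])
    moreover have "u \<in> ?A" using Suc \<open>0 < u\<close> by auto
    ultimately have "Inf ?A < u" by (metis (no_types, lifting) cInf_lower order_le_less)
    then obtain l where "l \<in> ?A" "l < u"
      using cInf_lessD[of ?A u] \<open>u \<in> ?A\<close> by blast
    have *: "N s \<omega> = N u \<omega>" if "l < s" "s \<le> u" for s
    proof -
      have "0 \<le> l" "k < N l \<omega>" using \<open>l \<in> ?A\<close> by auto
      then show ?thesis
        using mono_N[OF \<omega>, of l s] mono_N[OF \<omega>, of s u] that Suc by linarith
    qed
    show ?thesis
    proof (rule that[of l])
      show "0 \<le> l" using \<open>l \<in> ?A\<close> by simp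
    qed (fact \<open>l < u\<close>, rule *)
  qed
  obtain e where e: "u < e" "\<And>s. u \<le> s \<Longrightarrow> s < e \<Longrightarrow> N s \<omega> = N u \<omega>"
    using constant_right_N[OF \<omega> less_imp_le[OF \<open>0 < u\<close>]] by blast
  have "\<forall>\<^sub>F s in at u. s \<in> {l<..<e}"
    using l(2) e(1) by (intro eventually_at_in_open') auto
  then show "\<forall>\<^sub>F s in at u. N s \<omega> = N u \<omega>"
  proof eventually_elim
    case (elim s)
    then have "l < s" "s < e" by simp_all
    show ?case
    proof (cases "s \<le> u")
      case True
      with \<open>l < s\<close> show ?thesis by (rule l(3))
    next
      case False
      then show ?thesis using \<open>s < e\<close> by (intro e(2)[rule_format]) simp
    qed
  qed
qed

text \<open>Right continuity yields joint measurability: the process is the pointwise limit of its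
  values at grid points to the right of the time. The clamp \<open>max 0 u\<close> keeps all times
  in the range that the axioms constrain.\<close>

lemma measurable_N_pair [measurable]:
  "(\<lambda>(u, \<omega>). N (max 0 u) \<omega>) \<in> borel \<Otimes>\<^sub>M G \<rightarrow>\<^sub>M count_space UNIV"
proof -
  \<comment> \<open>The grid point used below is \<open>Suc (g m u) / Suc m\<close>, strictly larger
    than \<open>max 0 u\<close>, as a limit along \<open>at_right\<close> demands.\<close>
  define g :: "nat \<Rightarrow> real \<Rightarrow> nat" where "g m u = nat \<lfloor>max 0 u * real (Suc m)\<rfloor>" for m u
  have g_gt: "max 0 u < real (Suc (g m u)) / real (Suc m)" for m u
  proof -
    have "max 0 u * real (Suc m) < real (Suc (g m u))"
      unfolding g_def by (simp add: of_nat_nat) linarith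
    then show ?thesis by (subst pos_less_divide_eq) auto
  qed
  have g_le: "real (Suc (g m u)) / real (Suc m) \<le> max 0 u + 1 / real (Suc m)" for m u
  proof -
    have "real (g m u) \<le> max 0 u * real (Suc m)"
      unfolding g_def by (simp add: of_nat_nat)
    then have "real (Suc (g m u)) \<le> (max 0 u + 1 / real (Suc m)) * real (Suc m)"
      by (simp add: algebra_simps add_divide_distrib)
    then show ?thesis by (subst pos_divide_le_eq) auto
  qed
  have lim: "(\<lambda>m. real (N (real (Suc (g m u)) / real (Suc m)) \<omega>)) \<longlonglongrightarrow> real (N (max 0 u) \<omega>)"
    if \<omega>: "\<omega> \<in> space G" for u \<omega>
  proof -
    have "(\<lambda>m. real (Suc (g m u)) / real (Suc m)) \<longlonglongrightarrow> max 0 u"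
    proof (rule tendsto_sandwich[OF _ _ tendsto_const])
      show "(\<lambda>m. max 0 u + 1 / real (Suc m)) \<longlonglongrightarrow> max 0 u"
        using tendsto_add[OF tendsto_const LIMSEQ_inverse_real_of_nat] by (simp add: inverse_eq_divide)
    qed (use g_gt g_le in \<open>auto intro!: always_eventually less_imp_le\<close>)
    then have "filterlim (\<lambda>m. real (Suc (g m u)) / real (Suc m)) (at_right (max 0 u)) sequentially"
      using g_gt[of u] by (auto simp: filterlim_at intro!: always_eventually less_imp_neq[symmetric] simp del: of_nat_Suc)
    from eventually_compose_filterlim[OF eventually_at_right_N[OF \<omega>, of "max 0 u"] this]
    show ?thesis by (intro tendsto_eventually) (auto elim: eventually_mono)
  qed
  have g_meas: "(\<lambda>(u, \<omega>). real (N (real (Suc (g m u)) / real (Suc m)) \<omega>)) \<in> borel_measurable (borel \<Otimes>\<^sub>M G)" for m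
  proof -
    have "g m \<in> borel \<rightarrow>\<^sub>M count_space UNIV"
      unfolding g_def by measurable
    then have "(\<lambda>p. g m (fst p)) \<in> borel \<Otimes>\<^sub>M G \<rightarrow>\<^sub>M count_space UNIV"
      by (rule measurable_compose[OF measurable_fst])
    moreover have "(\<lambda>p. real (N (real (Suc k) / real (Suc m)) (snd p))) \<in> borel_measurable (borel \<Otimes>\<^sub>M G)" for k
      by (rule measurable_compose[OF measurable_compose[OF measurable_snd measurable_N]]) auto
    ultimately have "(\<lambda>p. real (N (real (Suc (g m (fst p))) / real (Suc m)) (snd p)))
        \<in> borel_measurable (borel \<Otimes>\<^sub>M G)"
      using measurable_compose_countable'[where I=UNIV and M="borel \<Otimes>\<^sub>M G" and
        f="\<lambda>k p. real (N (real (Suc k) / real (Suc m)) (snd p))" and g="\<lambda>p. g m (fst p)"]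
      by blast
    then show ?thesis by (simp add: case_prod_beta')
  qed
  have "(\<lambda>(u, \<omega>). real (N (max 0 u) \<omega>)) \<in> borel_measurable (borel \<Otimes>\<^sub>M G)"
    by (rule borel_measurable_LIMSEQ_real[OF _ g_meas]) (use lim in \<open>auto simp: space_pair_measure\<close>)
  \<comment> \<open>The limit was taken in the reals; the floor brings it back to
    \<open>nat\<close>.\<close>
  then have "(\<lambda>p. nat \<lfloor>(\<lambda>(u, \<omega>). real (N (max 0 u) \<omega>)) p\<rfloor>) \<in> borel \<Otimes>\<^sub>M G \<rightarrow>\<^sub>M count_space UNIV"
    by measurable
  then show ?thesis by (simp add: case_prod_beta')
qed

lemma set_integrable_N:
  fixes g :: "nat \<Rightarrow> real"
  assumes \<omega>: "\<omega> \<in> space G"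
  shows "set_integrable lborel {0..s} (\<lambda>u. g (N u \<omega>))"
proof -
  \<comment> \<open>On \<open>{0..s}\<close> the path takes only values up to
    \<open>N s \<omega>\<close>, so an arbitrary \<open>g\<close> is bounded along it.\<close>
  let ?B = "Max ((\<lambda>n. \<bar>g n\<bar>) ` {..N s \<omega>})"
  have [measurable]: "(\<lambda>u. N (max 0 u) \<omega>) \<in> borel \<rightarrow>\<^sub>M count_space UNIV"
    using measurable_compose[OF measurable_Pair2'[OF \<omega>] measurable_N_pair] by simp
  have "set_integrable lborel {0..s} (\<lambda>u. g (N (max 0 u) \<omega>))"
    unfolding set_integrable_def
  proof (rule integrableI_bounded_set_indicator[where B="?B"])
    show "AE u in lborel. u \<in> {0..s} \<longrightarrow> norm (g (N (max 0 u) \<omega>)) \<le> ?B"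
      using mono_N[OF \<omega>, of _ s] by (intro AE_I2) (auto intro!: Max_ge)
  qed (auto simp: emeasure_lborel_Icc_eq)
  then show ?thesis
    by (rule set_integrable_cong[THEN iffD1, rotated 3]) auto
qed

lemma integral_N_eq:
  fixes g :: "nat \<Rightarrow> real"
  assumes \<omega>: "\<omega> \<in> space G"
  shows "integral {0..s} (\<lambda>u. g (N u \<omega>)) = (LINT u|lborel. indicator {0..s} u * g (N (max 0 u) \<omega>))"
proof -
  have "integral {0..s} (\<lambda>u. g (N u \<omega>)) = (LINT u:{0..s}|lborel. g (N u \<omega>))"
    using set_borel_integral_eq_integral(2)[OF set_integrable_N[OF \<omega>]] by simp
  also have "\<dots> = (LINT u:{0..s}|lborel. g (N (max 0 u) \<omega>))"
    by (rule set_lebesgue_integral_cong) auto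
  finally show ?thesis by (simp add: set_lebesgue_integral_def)
qed

lemma integrable_on_N:
  fixes g :: "nat \<Rightarrow> real"
  assumes \<omega>: "\<omega> \<in> space G"
  shows "(\<lambda>u. g (N u \<omega>)) integrable_on {0..s}"
  using set_borel_integral_eq_integral(1)[OF set_integrable_N[OF \<omega>]] .

text \<open>The integrand may depend on the outcome beyond \<open>N\<close>, because the direction
  after \<open>n\<close> events is itself random. The gauge integral is rewritten as a Lebesgue
  integral, for which measurability in a parameter is available.\<close>

lemma measurable_integral_N:
  fixes F :: "nat \<Rightarrow> 'a \<Rightarrow> real"
  assumes [measurable]: "\<And>n. F n \<in> borel_measurable G"
  shows "(\<lambda>(s, \<omega>). integral {0..s} (\<lambda>u. F (N u \<omega>) \<omega>)) \<in> borel_measurable (borel \<Otimes>\<^sub>M G)"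
proof -
  let ?B = "(borel \<Otimes>\<^sub>M G) \<Otimes>\<^sub>M (borel :: real measure)"
  have "(\<lambda>z. (snd z, snd (fst z))) \<in> ?B \<rightarrow>\<^sub>M borel \<Otimes>\<^sub>M G"
    by measurable
  from measurable_compose[OF this measurable_N_pair]
  have "(\<lambda>z. N (max 0 (snd z)) (snd (fst z))) \<in> ?B \<rightarrow>\<^sub>M count_space UNIV"
    by simp
  moreover have "(\<lambda>z. F n (snd (fst z))) \<in> borel_measurable ?B" for n
    by measurable
  ultimately have "(\<lambda>z. F (N (max 0 (snd z)) (snd (fst z))) (snd (fst z))) \<in> borel_measurable ?B"
    using measurable_compose_countable'[where I=UNIV and M="?B" and f="\<lambda>n z. F n (snd (fst z))"]
    by blast
  moreover have "(\<lambda>z. if 0 \<le> snd z \<and> snd z \<le> fst (fst z) then 1 else 0 :: real) \<in> borel_measurable ?B"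
    by measurable
  ultimately have "(\<lambda>z. (if 0 \<le> snd z \<and> snd z \<le> fst (fst z) then 1 else 0) *
      F (N (max 0 (snd z)) (snd (fst z))) (snd (fst z))) \<in> borel_measurable ?B"
    by (rule borel_measurable_times[rotated])
  then have "(\<lambda>z. indicat_real {0..fst (fst z)} (snd z) *
      F (N (max 0 (snd z)) (snd (fst z))) (snd (fst z))) \<in> borel_measurable ?B"
    by (simp add: indicator_def of_bool_def)
  moreover have "sets ?B = sets ((borel \<Otimes>\<^sub>M G) \<Otimes>\<^sub>M lborel)"
    by (intro sets_pair_measure_cong) simp_all
  ultimately have "(\<lambda>z. indicat_real {0..fst (fst z)} (snd z) *
      F (N (max 0 (snd z)) (snd (fst z))) (snd (fst z))) \<in> borel_measurable ((borel \<Otimes>\<^sub>M G) \<Otimes>\<^sub>M lborel)"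
    using measurable_cong_sets[OF _ refl] by blast
  then have *: "(\<lambda>p. LINT u|lborel. (indicator {0..fst p} u * F (N (max 0 u) (snd p)) (snd p)))
      \<in> borel_measurable (borel \<Otimes>\<^sub>M G)"
    by (intro lborel.borel_measurable_lebesgue_integral) (simp add: case_prod_beta')
  show ?thesis
  proof (rule measurable_cong[THEN iffD1, OF _ *])
    fix p :: "real \<times> 'a" assume "p \<in> space (borel \<Otimes>\<^sub>M G)"
    then have "snd p \<in> space G" by (auto simp: space_pair_measure)
    from integral_N_eq[OF this, of "fst p" "\<lambda>n. F n (snd p)"]
    show "(LINT u|lborel. (indicator {0..fst p} u * F (N (max 0 u) (snd p)) (snd p))) =
      (case p of (s, \<omega>) \<Rightarrow> integral {0..s} (\<lambda>u. F (N u \<omega>) \<omega>))"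
      by (simp add: case_prod_beta')
  qed
qed

end

section \<open>The time spent at even values\<close>

text \<open>A gauge integral, like the one in \<open>position\<close>, so that the two combine
  pathwise and the fundamental theorem of calculus applies directly.\<close>

definition even_time :: "(real \<Rightarrow> 'a \<Rightarrow> nat) \<Rightarrow> real \<Rightarrow> 'a \<Rightarrow> real" where
  "even_time N s \<omega> = integral {0..s} (\<lambda>u. of_bool (even (N u \<omega>)))"

context counting_process
begin

lemma measurable_even_time_pair [measurable]:
  "(\<lambda>(s, \<omega>). even_time N s \<omega>) \<in> borel_measurable (borel \<Otimes>\<^sub>M G)"
  unfolding even_time_def using measurable_integral_N[of "\<lambda>n \<omega>. of_bool (even n)"] by simp

lemma measurable_even_time [measurable]: "even_time N s \<in> borel_measurable G"
  using measurable_compose[OF measurable_Pair1' measurable_even_time_pair, of s] by simp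

lemma integrable_on_N_subinterval:
  fixes g :: "nat \<Rightarrow> real"
  assumes "\<omega> \<in> space G" "0 \<le> a"
  shows "(\<lambda>u. g (N u \<omega>)) integrable_on {a..b}"
  using integrable_on_N[OF assms(1), of g b] by (rule integrable_on_subinterval) (use assms in auto)

lemma even_time_nonneg: "\<omega> \<in> space G \<Longrightarrow> 0 \<le> even_time N s \<omega>"
  unfolding even_time_def by (rule integral_nonneg[OF integrable_on_N]) auto

lemma even_time_le:
  assumes "\<omega> \<in> space G" "0 \<le> s"
  shows "even_time N s \<omega> \<le> s"
proof -
  have "even_time N s \<omega> \<le> integral {0..s} (\<lambda>_. 1)"
    unfolding even_time_def by (rule integral_le[OF integrable_on_N[OF assms(1)]]) auto
  with assms show ?thesis by simp
qed

text \<open>Where the path is locally constant the even time has derivative 1 or 0 according to the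
  parity of \<open>N\<close>, and the chain rule does the rest. This is the engine that raises the
  order of a moment by one.\<close>

lemma even_time_power_has_integral:
  assumes \<omega>: "\<omega> \<in> space G" and t: "0 \<le> t"
  shows "((\<lambda>s. real (Suc k) * (even_time N s \<omega> ^ k * of_bool (even (N s \<omega>))))
    has_integral even_time N t \<omega> ^ Suc k) {0..t}"
proof -
  obtain S where S: "finite S" "\<And>u. u \<in> {0<..<t} - S \<Longrightarrow> \<forall>\<^sub>F s in at u. N s \<omega> = N u \<omega>"
    using locally_constant_N[OF \<omega>] by metis
  have cont: "continuous_on {0..t} (\<lambda>s. even_time N s \<omega>)"
    unfolding even_time_def by (rule indefinite_integral_continuous_1) (rule integrable_on_N[OF \<omega>])
  have "((\<lambda>s. real (Suc k) * (even_time N s \<omega> ^ k * of_bool (even (N s \<omega>))))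
    has_integral even_time N t \<omega> ^ Suc k - even_time N 0 \<omega> ^ Suc k) {0..t}"
  \<comment> \<open>This form of the theorem tolerates the finite set \<open>S\<close> of jump times
    and asks only for continuity there.\<close>
  proof (rule fundamental_theorem_of_calculus_interior_strong[OF S(1) t])
    fix u assume u: "u \<in> {0<..<t} - S"
    have "continuous (at u within {0..t}) (\<lambda>s. of_bool (even (N s \<omega>)) :: real)"
    proof -
      have "\<forall>\<^sub>F s in at u. of_bool (even (N s \<omega>)) = (of_bool (even (N u \<omega>)) :: real)"
        using S(2)[OF u] by eventually_elim simp
      then have "continuous (at u) (\<lambda>s. of_bool (even (N s \<omega>)) :: real)"
        by (simp add: isCont_def tendsto_eventually)
      then show ?thesis by (rule continuous_at_imp_continuous_within)
    qed
    then have "((\<lambda>s. even_time N s \<omega>) has_vector_derivative of_bool (even (N u \<omega>))) (at u within {0..t})"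
      unfolding even_time_def
      using integral_has_vector_derivative_continuous_at[where S="{}", OF integrable_on_N[OF \<omega>], of u t "\<lambda>n. of_bool (even n)"] u
      by (simp del: of_bool_eq_iff)
    moreover have "at u within {0..t} = at u"
      using u by (intro at_within_interior) auto
    ultimately have "((\<lambda>s. even_time N s \<omega>) has_real_derivative of_bool (even (N u \<omega>))) (at u)"
      by (simp add: has_real_derivative_iff_has_vector_derivative)
    from DERIV_power[OF this, of "Suc k"]
    show "((\<lambda>s. even_time N s \<omega> ^ Suc k) has_vector_derivative
      real (Suc k) * (even_time N u \<omega> ^ k * of_bool (even (N u \<omega>)))) (at u)"
      by (simp add: has_real_derivative_iff_has_vector_derivative[symmetric] mult_ac)
  qed (intro continuous_intros cont)
  then show ?thesis by (simp add: even_time_def)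
qed

text \<open>A cell without a jump contributes no error; a cell with a jump contributes at most
  \<open>h\<close>, hence at most \<open>h\<close> times the increment of \<open>N\<close> over it.
  The increments telescope.\<close>

lemma even_time_Riemann_sum:
  assumes \<omega>: "\<omega> \<in> space G" and h: "0 \<le> h"
  shows "\<bar>even_time N (real m * h) \<omega> - (\<Sum>i<m. h * of_bool (even (N (real (Suc i) * h) \<omega>)))\<bar>
    \<le> h * real (N (real m * h) \<omega>)"
proof (induction m)
  case 0
  then show ?case using h by (simp add: even_time_def)
next
  case (Suc m)
  let ?f = "\<lambda>u. of_bool (even (N u \<omega>)) :: real"
  define a where "a = real m * h"
  define b where "b = real (Suc m) * h"
  have ab: "0 \<le> a" "a \<le> b" and h_eq: "h = b - a" using h by (auto simp: a_def b_def algebra_simps)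
  have int: "?f integrable_on {x..y}" if "0 \<le> x" for x y
    using integrable_on_N_subinterval[OF \<omega> that] .
  have split: "even_time N b \<omega> = even_time N a \<omega> + integral {a..b} ?f"
    unfolding even_time_def
    using Henstock_Kurzweil_Integration.integral_combine[of 0 a b ?f] ab int by simp
  have "\<bar>integral {a..b} ?f - h * ?f b\<bar> \<le> h * (real (N b \<omega>) - real (N a \<omega>))"
  proof (cases "N a \<omega> = N b \<omega>")
    case True
    have "integral {a..b} ?f = integral {a..b} (\<lambda>_. ?f b)"
    proof (rule integral_cong)
      fix u assume "u \<in> {a..b}"
      then have "N a \<omega> \<le> N u \<omega>" "N u \<omega> \<le> N b \<omega>"
        using mono_N[OF \<omega>, of a u] mono_N[OF \<omega>, of u b] ab by auto
      then show "?f u = ?f b" using True by simp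
    qed
    then show ?thesis using True ab by (simp add: h_eq)
  next
    case False
    then have "N a \<omega> < N b \<omega>" using mono_N[OF \<omega>, of a b] ab by auto
    then have "h * 1 \<le> h * (real (N b \<omega>) - real (N a \<omega>))"
      using h by (intro mult_left_mono) auto
    moreover have "0 \<le> integral {a..b} ?f"
      by (rule integral_nonneg[OF int]) (use ab in auto)
    moreover have "integral {a..b} ?f \<le> integral {a..b} (\<lambda>_. 1)"
      by (rule integral_le[OF int]) (use ab in auto)
    moreover have "0 \<le> h * ?f b" "h * ?f b \<le> h" using h by auto
    ultimately show ?thesis using ab h_eq by (simp add: abs_le_iff)
  qed
  moreover have "\<bar>even_time N a \<omega> - (\<Sum>i<m. h * ?f (real (Suc i) * h))\<bar> \<le> h * real (N a \<omega>)"
    using Suc by (simp add: a_def)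
  ultimately have "\<bar>even_time N b \<omega> - ((\<Sum>i<m. h * ?f (real (Suc i) * h)) + h * ?f b)\<bar> \<le> h * real (N b \<omega>)"
    unfolding split right_diff_distrib by linarith
  then show ?case unfolding sum.lessThan_Suc b_def .
qed

text \<open>The approximants depend on the path only through its values at finitely many grid
  points, the form in which independence of increments can be applied.\<close>

lemma even_time_Riemann_tendsto:
  assumes \<omega>: "\<omega> \<in> space G" and s: "0 \<le> s"
  shows "(\<lambda>m. \<Sum>i<Suc m. s / real (Suc m) * of_bool (even (N (real (Suc i) * (s / real (Suc m))) \<omega>)))
    \<longlonglongrightarrow> even_time N s \<omega>"
proof -
  have "(\<lambda>m. s * real (N s \<omega>) * inverse (real (Suc m))) \<longlonglongrightarrow> s * real (N s \<omega>) * 0"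
    by (intro tendsto_intros LIMSEQ_inverse_real_of_nat)
  then have lim: "(\<lambda>m. s / real (Suc m) * real (N s \<omega>)) \<longlonglongrightarrow> 0"
    by (simp add: field_simps)
  have "\<bar>(\<Sum>i<Suc m. s / real (Suc m) * of_bool (even (N (real (Suc i) * (s / real (Suc m))) \<omega>))) - even_time N s \<omega>\<bar>
    \<le> s / real (Suc m) * real (N s \<omega>)" for m
  proof -
    have "real (Suc m) * (s / real (Suc m)) = s" by simp
    then show ?thesis
      using even_time_Riemann_sum[OF \<omega>, of "s / real (Suc m)" "Suc m"] s
      by (metis abs_minus_commute divide_nonneg_nonneg of_nat_0_le_iff)
  qed
  then show ?thesis
    by (intro LIM_zero_cancel[OF Lim_null_comparison[OF _ lim]]) (auto intro!: always_eventually)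
qed

end

section \<open>A Beta integral and a factorial sum\<close>

lemma has_integral_Beta_nat:
  fixes t :: real
  assumes "0 \<le> t"
  shows "((\<lambda>s. s ^ a * (t - s) ^ b) has_integral fact a * fact b / fact (a + b + 1) * t ^ (a + b + 1)) {0..t}"
proof (induction b arbitrary: a)
  case 0
  have "((\<lambda>s. s ^ a) has_integral t ^ Suc a / real (Suc a) - 0 ^ Suc a / real (Suc a)) {0..t}"
    using assms
    by (intro fundamental_theorem_of_calculus)
       (auto intro!: derivative_eq_intros
         simp: has_real_derivative_iff_has_vector_derivative[symmetric] simp del: power_Suc of_nat_Suc)
  moreover have "fact a * fact 0 / fact (a + 0 + 1) * t ^ (a + 0 + 1) = t ^ Suc a / real (Suc a)"
    by (simp add: divide_simps)
  ultimately show ?case by (simp del: power_Suc fact_Suc of_nat_Suc)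
next
  case (Suc b)
  \<comment> \<open>Integration by parts: the difference is the derivative of
    \<open>s ^ Suc a * (t - s) ^ Suc b / real (Suc a)\<close>, which vanishes at both ends.\<close>
  have "((\<lambda>s. s ^ a * (t - s) ^ Suc b - real (Suc b) / real (Suc a) * (s ^ Suc a * (t - s) ^ b))
    has_integral t ^ Suc a * (t - t) ^ Suc b / real (Suc a) - 0 ^ Suc a * (t - 0) ^ Suc b / real (Suc a)) {0..t}"
    using assms
    by (intro fundamental_theorem_of_calculus)
       (auto intro!: derivative_eq_intros
         simp: has_real_derivative_iff_has_vector_derivative[symmetric] field_simps
         simp del: power_Suc of_nat_Suc)
  from has_integral_add[OF this has_integral_mult_right[OF Suc[of "Suc a"], of "real (Suc b) / real (Suc a)"]]
  have "((\<lambda>s. s ^ a * (t - s) ^ Suc b) has_integral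
    real (Suc b) / real (Suc a) * (fact (Suc a) * fact b / fact (Suc a + b + 1) * t ^ (Suc a + b + 1))) {0..t}"
    by (simp del: of_nat_Suc power_Suc fact_Suc)
  moreover have "real (Suc b) / real (Suc a) * (fact (Suc a) * fact b / fact (Suc a + b + 1) * t ^ (Suc a + b + 1))
    = fact a * fact (Suc b) / fact (a + Suc b + 1) * t ^ (a + Suc b + 1)"
    by (simp add: fact_Suc[of a] fact_Suc[of b] del: of_nat_Suc power_Suc fact_Suc)
  ultimately show ?case by (simp add: mult_ac)
qed

text \<open>The hockey-stick identity, multiplied by \<open>fact (Suc k)\<close>: the binomials
  \<open>(k + i) choose k\<close> for \<open>i \<le> d\<close> sum to
  \<open>(k + d + 1) choose (k + 1)\<close>.\<close>

lemma sum_rising_fact_ratio: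
  "(\<Sum>i\<le>d. fact (k + i) / fact i) * real (Suc k) = fact (Suc k + d) / (fact d :: real)"
proof (induction d)
  case 0
  then show ?case by simp
next
  case (Suc d)
  have "(\<Sum>i\<le>Suc d. fact (k + i) / fact i) * real (Suc k)
    = fact (Suc k + d) / (fact d :: real) + fact (k + Suc d) / fact (Suc d) * real (Suc k)"
    using Suc by (simp add: distrib_right)
  also have "fact (Suc k + d) = (fact (k + Suc d) :: real)"
    by simp
  also have "fact (k + Suc d) / (fact d :: real) + fact (k + Suc d) / fact (Suc d) * real (Suc k)
    = fact (k + Suc d) * real (Suc d + Suc k) / fact (Suc d)"
    by (simp add: fact_Suc[of d] divide_simps del: fact_Suc add_Suc_right) (simp add: algebra_simps del: fact_Suc add_Suc_right)
  also have "\<dots> = fact (Suc k + Suc d) / fact (Suc d)"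
  proof -
    have "Suc k + Suc d = Suc (k + Suc d)" "Suc d + Suc k = Suc (k + Suc d)" by simp_all
    then show ?thesis by (simp only: fact_Suc[of "k + Suc d"] mult.commute)
  qed
  finally show ?case .
qed

section \<open>Measures determined by their moments\<close>

lemma (in finite_borel_measure) integrable_AE_bounded:
  fixes f :: "real \<Rightarrow> real"
  assumes "AE x in M. x \<in> {a..b}" "continuous_on {a..b} f" "f \<in> borel_measurable borel"
  shows "integrable M f"
proof -
  have "bounded (f ` {a..b})"
    using assms(2) by (intro compact_imp_bounded compact_continuous_image) auto
  then obtain B where "\<And>x. x \<in> {a..b} \<Longrightarrow> norm (f x) \<le> B" unfolding bounded_iff by blast
  then have "AE x in M. norm (f x) \<le> B" using assms(1) by auto
  then show ?thesis
    by (rule integrable_const_bound) (use assms(3) in \<open>simp add: measurable_cong_sets[OF M_is_borel refl]\<close>)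
qed

text \<open>Equal moments give equal integrals of polynomials, then of continuous functions by
  Weierstrass approximation on \<open>{a..b}\<close>, then equal distribution functions by
  approximating half-line indicators with continuous steps.\<close>

lemma finite_borel_measure_eq_of_moments:
  fixes \<mu> \<nu> :: "real measure"
  assumes \<mu>: "finite_borel_measure \<mu>" and \<nu>: "finite_borel_measure \<nu>"
    and \<mu>_AE: "AE x in \<mu>. x \<in> {a..b}" and \<nu>_AE: "AE x in \<nu>. x \<in> {a..b}"
    and moments: "\<And>k. (LINT x|\<mu>. x ^ k) = (LINT x|\<nu>. x ^ k)"
  shows "\<mu> = \<nu>"
proof -
  interpret \<mu>: finite_borel_measure \<mu> by fact
  interpret \<nu>: finite_borel_measure \<nu> by fact
  have poly: "(LINT x|\<mu>. g x) = (LINT x|\<nu>. g x)" if "real_polynomial_function g" for g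
  proof -
    from that obtain c n where g: "g = (\<lambda>x. \<Sum>i\<le>n. c i * x ^ i)"
      unfolding real_polynomial_function_iff_sum by blast
    have "integrable \<mu> (\<lambda>x. x ^ i)" "integrable \<nu> (\<lambda>x. x ^ i)" for i
      by (intro \<mu>.integrable_AE_bounded[OF \<mu>_AE] \<nu>.integrable_AE_bounded[OF \<nu>_AE] continuous_intros; simp)+
    then show ?thesis unfolding g by (simp add: moments)
  qed
  have cont: "(LINT x|\<mu>. f x) = (LINT x|\<nu>. f x)" if f: "continuous_on UNIV f" for f :: "real \<Rightarrow> real"
  proof -
    have f': "continuous_on {a..b} f" "f \<in> borel_measurable borel"
      using f by (auto intro: continuous_on_subset borel_measurable_continuous_onI)
    define K where "K = measure \<mu> (space \<mu>) + measure \<nu> (space \<nu>)"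
    have bound: "\<bar>(LINT x|\<mu>. f x) - (LINT x|\<nu>. f x)\<bar> \<le> e * K" if "0 < e" for e
    proof -
      obtain g where g: "real_polynomial_function g" "\<And>x. x \<in> {a..b} \<Longrightarrow> \<bar>f x - g x\<bar> < e"
        using Stone_Weierstrass_real_polynomial_function[OF compact_Icc f'(1) \<open>0 < e\<close>] by blast
      obtain c n where g_eq: "g = (\<lambda>x. \<Sum>i\<le>n. c i * x ^ i)"
        using g(1) unfolding real_polynomial_function_iff_sum by blast
      have "continuous_on UNIV g" unfolding g_eq by (intro continuous_intros)
      then have g': "continuous_on {a..b} g" "g \<in> borel_measurable borel"
        by (blast intro: continuous_on_subset, rule borel_measurable_continuous_onI)
      have d: "\<bar>(LINT x|\<kappa>. f x) - (LINT x|\<kappa>. g x)\<bar> \<le> e * measure \<kappa> (space \<kappa>)"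
        if "finite_borel_measure \<kappa>" "AE x in \<kappa>. x \<in> {a..b}" for \<kappa> :: "real measure"
      proof -
        interpret \<kappa>: finite_borel_measure \<kappa> by fact
        have i: "integrable \<kappa> f" "integrable \<kappa> g"
          by (rule \<kappa>.integrable_AE_bounded[OF that(2) f'], rule \<kappa>.integrable_AE_bounded[OF that(2) g'])
        have "\<bar>(LINT x|\<kappa>. f x) - (LINT x|\<kappa>. g x)\<bar> = \<bar>LINT x|\<kappa>. f x - g x\<bar>"
          using i by simp
        also have "\<dots> \<le> (LINT x|\<kappa>. \<bar>f x - g x\<bar>)"
          by (rule integral_abs_bound)
        also have "\<dots> \<le> (LINT x|\<kappa>. e)"
        proof (rule integral_mono_AE)
          show "AE x in \<kappa>. \<bar>f x - g x\<bar> \<le> e"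
            using that(2) by eventually_elim (rule less_imp_le[OF g(2)])
        qed (use i in auto)
        finally show ?thesis by (simp add: mult.commute)
      qed
      show ?thesis
        using d[OF \<mu> \<mu>_AE] d[OF \<nu> \<nu>_AE] poly[OF g(1)] unfolding K_def distrib_left by linarith
    qed
    have "0 \<le> K" by (simp add: K_def)
    show ?thesis
    proof (rule ccontr)
      assume "\<not> ?thesis"
      then have pos: "0 < \<bar>(LINT x|\<mu>. f x) - (LINT x|\<nu>. f x)\<bar>" (is "0 < ?d") by simp
      \<comment> \<open>This tolerance makes the total error less than half of the supposed gap; the
        \<open>+ 1\<close> keeps it well defined for \<open>K = 0\<close>.\<close>
      have "?d \<le> ?d / (2 * (K + 1)) * K"
        by (rule bound) (use pos \<open>0 \<le> K\<close> in auto)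
      moreover have "?d / (2 * (K + 1)) * K < ?d * 1"
      proof -
        have "K / (2 * (K + 1)) < 1" using \<open>0 \<le> K\<close> by (simp add: divide_simps)
        then have "?d * (K / (2 * (K + 1))) < ?d * 1" using pos by (intro mult_strict_left_mono) auto
        then show ?thesis by simp
      qed
      ultimately show False by simp
    qed
  qed
  \<comment> \<open>The step is 1 up to \<open>x\<close> and falls linearly to 0 at
    \<open>x + inverse (real (Suc n))\<close>. Descending on the right of \<open>x\<close> keeps the
    point \<open>x\<close> itself, so the limit is the indicator of \<open>{..x}\<close>.\<close>
  have step: "(\<lambda>n. LINT y|\<kappa>. cts_step x (x + inverse (real (Suc n))) y) \<longlonglongrightarrow> cdf \<kappa> x"
    if "finite_borel_measure \<kappa>" for \<kappa> :: "real measure" and x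
  proof -
    interpret \<kappa>: finite_borel_measure \<kappa> by fact
    have m: "cts_step x z \<in> borel_measurable \<kappa>" for x z
      unfolding measurable_cong_sets[OF \<kappa>.M_is_borel refl] cts_step_def[abs_def] by measurable
    have lim: "(\<lambda>n. cts_step x (x + inverse (real (Suc n))) y) \<longlonglongrightarrow> indicat_real {..x} y" for y
    proof (cases "y \<le> x")
      case True
      then show ?thesis by (simp add: cts_step_def)
    next
      case False
      then have "\<forall>\<^sub>F n in sequentially. inverse (real (Suc n)) < y - x"
        by (intro order_tendstoD[OF LIMSEQ_inverse_real_of_nat]) auto
      then have "\<forall>\<^sub>F n in sequentially. cts_step x (x + inverse (real (Suc n))) y = indicat_real {..x} y"
        by eventually_elim (use False in \<open>auto simp: cts_step_def simp del: of_nat_Suc\<close>)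
      then show ?thesis by (rule tendsto_eventually)
    qed
    have "(\<lambda>n. LINT y|\<kappa>. cts_step x (x + inverse (real (Suc n))) y) \<longlonglongrightarrow> (LINT y|\<kappa>. indicat_real {..x} y)"
    proof (rule integral_dominated_convergence[where w="\<lambda>_. 1"])
      show "AE y in \<kappa>. norm (cts_step x (x + inverse (real (Suc n))) y) \<le> 1" for n
        by (rule AE_I2) (auto simp: cts_step_def divide_simps simp del: of_nat_Suc)
      show "AE y in \<kappa>. (\<lambda>n. cts_step x (x + inverse (real (Suc n))) y) \<longlonglongrightarrow> indicat_real {..x} y"
        by (rule AE_I2) (rule lim)
      show "indicat_real {..x} \<in> borel_measurable \<kappa>"
        using \<kappa>.M_is_borel by (intro borel_measurable_indicator) simp
    qed (use m in simp_all)
    then show ?thesis using \<kappa>.M_is_borel by (simp add: cdf_def)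
  qed
  have "cdf \<mu> x = cdf \<nu> x" for x
  proof (rule LIMSEQ_unique[OF step[OF \<mu>]])
    have "continuous_on UNIV (cts_step x (x + inverse (real (Suc n))))" for n
      by (intro uniformly_continuous_imp_continuous cts_step_uniformly_continuous) simp
    from cont[OF this]
    show "(\<lambda>n. LINT y|\<mu>. cts_step x (x + inverse (real (Suc n))) y) \<longlonglongrightarrow> cdf \<nu> x"
      using step[OF \<nu>, of x] by simp
  qed
  then show ?thesis by (intro cdf_unique'[OF \<mu> \<nu>]) auto
qed

section \<open>The joint law of the Poisson process and its even time\<close>

sublocale poisson_process \<subseteq> counting_process M N
  by unfold_locales (simp_all add: N_measurable N_mono N_right_continuous)

context poisson_process
begin

section \<open>Laws of the increments\<close>

lemma borel_measurable_of_bool_N [measurable]: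
  "0 \<le> s \<Longrightarrow> (\<lambda>\<omega>. of_bool (P (N s \<omega>)) :: real) \<in> borel_measurable M"
  by (rule measurable_compose[OF N_measurable]) auto

lemma measurable_increment:
  assumes "0 \<le> s" "0 \<le> t"
  shows "(\<lambda>\<omega>. N t \<omega> - N s \<omega>) \<in> M \<rightarrow>\<^sub>M count_space UNIV"
proof -
  have "(\<lambda>\<omega>. (N t \<omega>, N s \<omega>)) \<in> M \<rightarrow>\<^sub>M count_space UNIV \<Otimes>\<^sub>M count_space UNIV"
    using N_measurable assms by (intro measurable_Pair) auto
  then have "(\<lambda>\<omega>. (N t \<omega>, N s \<omega>)) \<in> M \<rightarrow>\<^sub>M count_space (UNIV :: (nat \<times> nat) set)"
    by (simp add: pair_measure_countable)
  from measurable_compose[OF this, of "\<lambda>(m, n). m - n"] show ?thesis by simp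
qed

lemma borel_measurable_of_bool_increment [measurable]:
  "0 \<le> s \<Longrightarrow> 0 \<le> t \<Longrightarrow> (\<lambda>\<omega>. of_bool (P (N t \<omega> - N s \<omega>)) :: real) \<in> borel_measurable M"
  by (rule measurable_compose[OF measurable_increment]) auto

lemma expectation_of_bool: "Measurable.pred M P \<Longrightarrow> expectation (\<lambda>\<omega>. of_bool (P \<omega>)) = prob {\<omega> \<in> space M. P \<omega>}"
  by (subst Bochner_Integration.integral_cong[OF refl, of M _ "indicator {\<omega> \<in> space M. P \<omega>}"]) auto

text \<open>Covers \<open>s = t\<close> too, which \<open>poisson_increments\<close> leaves out:
  there both sides are 1 for \<open>l = 0\<close> and 0 otherwise. The case occurs at the end point
  of the later integral over \<open>{0..t}\<close>.\<close>

lemma expectation_increment: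
  assumes "0 < rate" "0 \<le> s" "s \<le> t"
  shows "expectation (\<lambda>\<omega>. of_bool (N t \<omega> - N s \<omega> = l)) = (rate * (t - s)) ^ l / fact l * exp (- (rate * (t - s)))"
proof (cases "s = t")
  case True
  then show ?thesis by (cases l) (auto simp: prob_space)
next
  case False
  then have "s < t" using assms by simp
  have *: "of_bool (n = l) = indicat_real {l} n" for n
    by (auto simp: indicator_def)
  have m: "(\<lambda>\<omega>. N t \<omega> - N s \<omega>) \<in> M \<rightarrow>\<^sub>M count_space UNIV"
    by (rule measurable_increment) (use assms in auto)
  have "expectation (\<lambda>\<omega>. of_bool (N t \<omega> - N s \<omega> = l)) = (LINT x|distr M (count_space UNIV) (\<lambda>\<omega>. N t \<omega> - N s \<omega>). indicat_real {l} x)"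
    by (subst integral_distr[OF m]) (simp_all add: *)
  also have "\<dots> = pmf (poisson_pmf (rate * (t - s))) l"
    unfolding poisson_increments[OF \<open>0 \<le> s\<close> \<open>s < t\<close>] by (simp add: measure_pmf_single)
  also have "\<dots> = (rate * (t - s)) ^ l / fact l * exp (- (rate * (t - s)))"
    using assms \<open>s < t\<close> by (subst pmf_poisson) auto
  finally show ?thesis .
qed

lemma even_time_power_bounded:
  "\<omega> \<in> space M \<Longrightarrow> 0 \<le> s \<Longrightarrow> \<bar>even_time N s \<omega> ^ k\<bar> \<le> s ^ k"
  using even_time_nonneg[of \<omega> s] even_time_le[of \<omega> s] by (auto simp: power_abs intro!: power_mono)

text \<open>Isolates the use of \<open>independent_increments\<close>: \<open>f\<close> sees the
  first \<open>m\<close> cells of a grid, \<open>g\<close> the single increment that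
  follows.\<close>

lemma expectation_grid_independent:
  fixes f :: "(nat \<Rightarrow> nat) \<Rightarrow> real" and g :: "nat \<Rightarrow> real"
  assumes h: "0 \<le> h" and t: "real m * h \<le> t"
    and f: "bounded (range f)" and g: "bounded (range g)"
  defines "X \<equiv> \<lambda>\<omega>. \<lambda>i\<in>{..<m}. N (real (Suc i) * h) \<omega> - N (real i * h) \<omega>"
  shows "expectation (\<lambda>\<omega>. f (X \<omega>) * g (N t \<omega> - N (real m * h) \<omega>))
    = expectation (\<lambda>\<omega>. f (X \<omega>)) * expectation (\<lambda>\<omega>. g (N t \<omega> - N (real m * h) \<omega>))"
proof -
  \<comment> \<open>After the \<open>m\<close> grid cells the sequence moves to \<open>t\<close> and
    stays there, so that \<open>D m\<close> is exactly the increment from \<open>real m * h\<close>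
    to \<open>t\<close>.\<close>
  define \<tau> where "\<tau> i = (if i \<le> m then real i * h else t)" for i
  define D where "D i \<omega> = N (\<tau> (Suc i)) \<omega> - N (\<tau> i) \<omega>" for i \<omega>
  have "incseq \<tau>"
    by (rule incseq_SucI) (use h t in \<open>auto simp: \<tau>_def algebra_simps not_less_eq_eq le_antisym\<close>)
  then have "indep_vars (\<lambda>_. count_space UNIV) D {..<Suc m}"
    unfolding D_def by (intro independent_increments) (simp add: \<tau>_def)
  then have "indep_var (PiM {..<m} (\<lambda>_. count_space UNIV)) (\<lambda>\<omega>. \<lambda>i\<in>{..<m}. D i \<omega>)
     (PiM {m} (\<lambda>_. count_space UNIV)) (\<lambda>\<omega>. \<lambda>i\<in>{m}. D i \<omega>)"
    by (rule indep_var_restrict) auto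
  \<comment> \<open>Finite products of countable discrete spaces are discrete, so every function of
    the increments is measurable.\<close>
  then have indep: "indep_var borel (f \<circ> (\<lambda>\<omega>. \<lambda>i\<in>{..<m}. D i \<omega>)) borel ((\<lambda>x. g (x m)) \<circ> (\<lambda>\<omega>. \<lambda>i\<in>{m}. D i \<omega>))"
    by (rule indep_var_compose) (simp_all add: count_space_PiM_finite)
  have rv: "random_variable borel (f \<circ> (\<lambda>\<omega>. \<lambda>i\<in>{..<m}. D i \<omega>))"
     "random_variable borel ((\<lambda>x. g (x m)) \<circ> (\<lambda>\<omega>. \<lambda>i\<in>{m}. D i \<omega>))"
    using indep by (auto dest: indep_var_rv1 indep_var_rv2)
  have "integrable M (f \<circ> (\<lambda>\<omega>. \<lambda>i\<in>{..<m}. D i \<omega>))"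
  proof -
    from f obtain B where "\<And>x. norm (f x) \<le> B" by (auto simp: bounded_iff)
    then show ?thesis using rv(1) by (intro integrable_const_bound[of _ B]) auto
  qed
  moreover have "integrable M ((\<lambda>x. g (x m)) \<circ> (\<lambda>\<omega>. \<lambda>i\<in>{m}. D i \<omega>))"
  proof -
    from g obtain B where "\<And>x. norm (g x) \<le> B" by (auto simp: bounded_iff)
    then show ?thesis using rv(2) by (intro integrable_const_bound[of _ B]) auto
  qed
  ultimately have "expectation (\<lambda>\<omega>. (f \<circ> (\<lambda>\<omega>. \<lambda>i\<in>{..<m}. D i \<omega>)) \<omega> * ((\<lambda>x. g (x m)) \<circ> (\<lambda>\<omega>. \<lambda>i\<in>{m}. D i \<omega>)) \<omega>)
    = expectation (f \<circ> (\<lambda>\<omega>. \<lambda>i\<in>{..<m}. D i \<omega>)) * expectation ((\<lambda>x. g (x m)) \<circ> (\<lambda>\<omega>. \<lambda>i\<in>{m}. D i \<omega>))"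
    by (rule indep_var_lebesgue_integral[OF indep])
  moreover have "(\<lambda>i\<in>{..<m}. D i \<omega>) = X \<omega>" for \<omega>
    unfolding X_def D_def \<tau>_def by (rule restrict_ext) auto
  moreover have "D m \<omega> = N t \<omega> - N (real m * h) \<omega>" for \<omega>
    by (simp add: D_def \<tau>_def)
  ultimately show ?thesis by (simp add: comp_def)
qed

text \<open>The first factor is a functional of the whole path up to \<open>s\<close>, out of direct
  reach of the axiom on increments. The identity holds for the Riemann sums \<open>R m\<close>, and
  both sides converge by dominated convergence with the bound \<open>s ^ k\<close>.\<close>

lemma expectation_even_time_increment:
  assumes s: "0 \<le> s" and st: "s \<le> t"
  shows "expectation (\<lambda>\<omega>. even_time N s \<omega> ^ k * of_bool (N s \<omega> = j) * of_bool (N t \<omega> - N s \<omega> = l))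
    = expectation (\<lambda>\<omega>. even_time N s \<omega> ^ k * of_bool (N s \<omega> = j)) * expectation (\<lambda>\<omega>. of_bool (N t \<omega> - N s \<omega> = l))"
proof -
  note [measurable] = borel_measurable_of_bool_N[OF s] borel_measurable_of_bool_increment[OF s order_trans[OF s st]]
  define R where "R m \<omega> = (\<Sum>i<Suc m. s / real (Suc m) * of_bool (even (N (real (Suc i) * (s / real (Suc m))) \<omega>)))" for m \<omega>
  have R_meas [measurable]: "R m \<in> borel_measurable M" for m
    unfolding R_def using s
    by (intro borel_measurable_sum borel_measurable_times borel_measurable_const borel_measurable_of_bool_N) auto
  have R_lim: "(\<lambda>m. R m \<omega>) \<longlonglongrightarrow> even_time N s \<omega>" if "\<omega> \<in> space M" for \<omega>
    unfolding R_def using even_time_Riemann_tendsto[OF that s] .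
  have R_bound: "norm (R m \<omega> ^ k) \<le> s ^ k" for m \<omega>
  proof -
    have "0 \<le> R m \<omega>" unfolding R_def using s by (intro sum_nonneg) auto
    moreover have "R m \<omega> \<le> (\<Sum>i<Suc m. s / real (Suc m) * 1)"
      unfolding R_def using s by (intro sum_mono mult_left_mono) auto
    ultimately show ?thesis using s by (auto simp: power_abs intro!: power_mono)
  qed
  have R_indep: "expectation (\<lambda>\<omega>. R m \<omega> ^ k * of_bool (N s \<omega> = j) * of_bool (N t \<omega> - N s \<omega> = l))
    = expectation (\<lambda>\<omega>. R m \<omega> ^ k * of_bool (N s \<omega> = j)) * expectation (\<lambda>\<omega>. of_bool (N t \<omega> - N s \<omega> = l))" for m
  proof -
    define h where "h = s / real (Suc m)"
    have h: "0 \<le> h" "real (Suc m) * h = s" using s by (auto simp: h_def)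
    \<comment> \<open>The Riemann sum as a function of the increments alone: as \<open>N\<close>
      starts at 0, its value at a grid point is the partial sum of the increments up to it.\<close>
    define f :: "(nat \<Rightarrow> nat) \<Rightarrow> real" where
      "f x = (\<Sum>i<Suc m. h * of_bool (even (\<Sum>r\<le>i. x r))) ^ k * of_bool ((\<Sum>r\<le>m. x r) = j)" for x
    have "norm (f x) \<le> s ^ k" for x
    proof -
      have "0 \<le> (\<Sum>i<Suc m. h * of_bool (even (\<Sum>r\<le>i. x r)))" using h by (intro sum_nonneg) auto
      moreover have "(\<Sum>i<Suc m. h * of_bool (even (\<Sum>r\<le>i. x r))) \<le> (\<Sum>i<Suc m. h * 1)"
        using h by (intro sum_mono mult_left_mono) auto
      ultimately have "\<bar>\<Sum>i<Suc m. h * of_bool (even (\<Sum>r\<le>i. x r))\<bar> ^ k \<le> s ^ k"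
        using h(2) by (intro power_mono) auto
      moreover have "norm (f x) \<le> \<bar>\<Sum>i<Suc m. h * of_bool (even (\<Sum>r\<le>i. x r))\<bar> ^ k * 1"
        unfolding f_def real_norm_def abs_mult power_abs by (intro mult_left_mono) auto
      ultimately show ?thesis by linarith
    qed
    then have f: "bounded (range f)" by (auto simp: bounded_iff)
    have N_eq: "N (real (Suc i) * h) \<omega> = (\<Sum>r\<le>i. N (real (Suc r) * h) \<omega> - N (real r * h) \<omega>)"
      if "\<omega> \<in> space M" for i \<omega>
    proof (induction i)
      case 0
      then show ?case using that N_zero by simp
    next
      case (Suc i)
      have "N (real (Suc i) * h) \<omega> \<le> N (real (Suc (Suc i)) * h) \<omega>"
        using h by (intro N_mono that mult_right_mono) auto
      then show ?case unfolding sum.atMost_Suc Suc[symmetric] by simp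
    qed
    let ?X = "\<lambda>\<omega>. \<lambda>i\<in>{..<Suc m}. N (real (Suc i) * h) \<omega> - N (real i * h) \<omega>"
    have eq: "f (?X \<omega>) = R m \<omega> ^ k * of_bool (N s \<omega> = j)" if \<omega>: "\<omega> \<in> space M" for \<omega>
    proof -
      have c: "(\<Sum>r\<le>i. ?X \<omega> r) = N (real (Suc i) * h) \<omega>" if "i < Suc m" for i
      proof (rule trans[OF _ N_eq[OF \<omega>, symmetric]], rule sum.cong[OF refl])
        fix r assume "r \<in> {..i}"
        with that have "r \<in> {..<Suc m}" by auto
        then show "?X \<omega> r = N (real (Suc r) * h) \<omega> - N (real r * h) \<omega>"
          by (simp only: restrict_apply')
      qed
      have "(\<Sum>r\<le>m. ?X \<omega> r) = N s \<omega>"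
        using c[of m] h(2) by simp
      moreover have "(\<Sum>i<Suc m. h * of_bool (even (\<Sum>r\<le>i. ?X \<omega> r))) = R m \<omega>"
        unfolding R_def h_def[symmetric] by (intro sum.cong refl) (simp only: c lessThan_iff)
      ultimately show ?thesis unfolding f_def by (simp only:)
    qed
    have g: "bounded (range (\<lambda>n. of_bool (n = l) :: real))"
      by (auto simp: bounded_iff intro!: exI[of _ 1])
    have "real (Suc m) * h \<le> t" using h st by simp
    note grid = expectation_grid_independent[OF h(1) this f g, unfolded h(2)]
    have "expectation (\<lambda>\<omega>. R m \<omega> ^ k * of_bool (N s \<omega> = j) * of_bool (N t \<omega> - N s \<omega> = l))
      = expectation (\<lambda>\<omega>. f (?X \<omega>) * of_bool (N t \<omega> - N s \<omega> = l))"
      by (rule Bochner_Integration.integral_cong[OF refl]) (simp only: eq)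
    also have "\<dots> = expectation (\<lambda>\<omega>. f (?X \<omega>)) * expectation (\<lambda>\<omega>. of_bool (N t \<omega> - N s \<omega> = l))"
      by (rule grid)
    also have "expectation (\<lambda>\<omega>. f (?X \<omega>)) = expectation (\<lambda>\<omega>. R m \<omega> ^ k * of_bool (N s \<omega> = j))"
      by (rule Bochner_Integration.integral_cong[OF refl]) (simp only: eq)
    finally show ?thesis .
  qed
  have "(\<lambda>m. expectation (\<lambda>\<omega>. R m \<omega> ^ k * of_bool (N s \<omega> = j) * of_bool (N t \<omega> - N s \<omega> = l)))
    \<longlonglongrightarrow> expectation (\<lambda>\<omega>. even_time N s \<omega> ^ k * of_bool (N s \<omega> = j) * of_bool (N t \<omega> - N s \<omega> = l))"
  proof (rule integral_dominated_convergence[where w="\<lambda>_. s ^ k"])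
    show "AE \<omega> in M. (\<lambda>m. R m \<omega> ^ k * of_bool (N s \<omega> = j) * of_bool (N t \<omega> - N s \<omega> = l))
      \<longlonglongrightarrow> even_time N s \<omega> ^ k * of_bool (N s \<omega> = j) * of_bool (N t \<omega> - N s \<omega> = l)"
      by (intro AE_I2 tendsto_intros R_lim)
    show "AE \<omega> in M. norm (R m \<omega> ^ k * of_bool (N s \<omega> = j) * of_bool (N t \<omega> - N s \<omega> = l)) \<le> s ^ k" for m
      using R_bound[of m] s by (intro AE_I2) auto
  qed simp_all
  moreover have "(\<lambda>m. expectation (\<lambda>\<omega>. R m \<omega> ^ k * of_bool (N s \<omega> = j)))
    \<longlonglongrightarrow> expectation (\<lambda>\<omega>. even_time N s \<omega> ^ k * of_bool (N s \<omega> = j))"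
  proof (rule integral_dominated_convergence[where w="\<lambda>_. s ^ k"])
    show "AE \<omega> in M. (\<lambda>m. R m \<omega> ^ k * of_bool (N s \<omega> = j)) \<longlonglongrightarrow> even_time N s \<omega> ^ k * of_bool (N s \<omega> = j)"
      by (intro AE_I2 tendsto_intros R_lim)
    show "AE \<omega> in M. norm (R m \<omega> ^ k * of_bool (N s \<omega> = j)) \<le> s ^ k" for m
      using R_bound[of m] s by (intro AE_I2) auto
  qed simp_all
  ultimately show ?thesis
    unfolding R_indep by (intro LIMSEQ_unique[OF _ tendsto_mult_right])
qed

text \<open>Trades the condition on \<open>N t\<close> for one on the increment, which is
  independent of the past. For \<open>i \<le> n div 2\<close> the difference
  \<open>n - 2 * i\<close> does not truncate, so each summand describes exactly one even value at
  time \<open>s\<close>.\<close>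

lemma of_bool_even_split:
  assumes \<omega>: "\<omega> \<in> space M" and s: "0 \<le> s" "s \<le> t"
  shows "of_bool (even (N s \<omega>)) * of_bool (N t \<omega> = n)
    = (\<Sum>i\<le>n div 2. of_bool (N s \<omega> = 2 * i) * of_bool (N t \<omega> - N s \<omega> = n - 2 * i) :: real)"
proof (cases "even (N s \<omega>) \<and> N t \<omega> = n")
  case True
  then obtain i where i: "N s \<omega> = 2 * i" by (auto elim: evenE)
  have "N s \<omega> \<le> n" using N_mono[OF \<omega> s] True by simp
  then have "i \<in> {..n div 2}" using i by auto
  have "(\<Sum>r\<le>n div 2. of_bool (N s \<omega> = 2 * r) * of_bool (N t \<omega> - N s \<omega> = n - 2 * r) :: real)
    = (\<Sum>r\<in>{i}. 1)"
    using \<open>i \<in> _\<close> i True by (intro sum.mono_neutral_cong_right) auto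
  then show ?thesis using True by simp
next
  case False
  have "(of_bool (N s \<omega> = 2 * i) * of_bool (N t \<omega> - N s \<omega> = n - 2 * i) :: real) = 0" if "i \<le> n div 2" for i
  proof (rule ccontr)
    assume "\<not> ?thesis"
    then have "N s \<omega> = 2 * i" "N t \<omega> - N s \<omega> = n - 2 * i" by (auto split: if_splits)
    moreover have "2 * i \<le> n" using that by auto
    ultimately have "even (N s \<omega>) \<and> N t \<omega> = n" using N_mono[OF \<omega> s] by auto
    with False show False by simp
  qed
  then show ?thesis using False by (auto simp del: mult_eq_0_iff)
qed

lemma expectation_even_time_even:
  assumes s: "0 \<le> s" "s \<le> t"
  shows "expectation (\<lambda>\<omega>. even_time N s \<omega> ^ k * of_bool (even (N s \<omega>)) * of_bool (N t \<omega> = n))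
    = (\<Sum>i\<le>n div 2. expectation (\<lambda>\<omega>. even_time N s \<omega> ^ k * of_bool (N s \<omega> = 2 * i))
        * expectation (\<lambda>\<omega>. of_bool (N t \<omega> - N s \<omega> = n - 2 * i)))"
proof -
  note [measurable] = borel_measurable_of_bool_N[OF s(1)]
    borel_measurable_of_bool_increment[OF s(1) order_trans[OF s]]
  have "expectation (\<lambda>\<omega>. even_time N s \<omega> ^ k * of_bool (even (N s \<omega>)) * of_bool (N t \<omega> = n))
    = expectation (\<lambda>\<omega>. \<Sum>i\<le>n div 2.
        even_time N s \<omega> ^ k * of_bool (N s \<omega> = 2 * i) * of_bool (N t \<omega> - N s \<omega> = n - 2 * i))"
    by (rule Bochner_Integration.integral_cong[OF refl])
       (simp only: mult.assoc of_bool_even_split[OF _ s] sum_distrib_left)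
  also have "\<dots> = (\<Sum>i\<le>n div 2. expectation (\<lambda>\<omega>.
        even_time N s \<omega> ^ k * of_bool (N s \<omega> = 2 * i) * of_bool (N t \<omega> - N s \<omega> = n - 2 * i)))"
  proof (rule Bochner_Integration.integral_sum)
    fix i
    show "integrable M (\<lambda>\<omega>. even_time N s \<omega> ^ k * of_bool (N s \<omega> = 2 * i) * of_bool (N t \<omega> - N s \<omega> = n - 2 * i))"
      by (rule integrable_const_bound[of _ "s ^ k"])
         (use even_time_power_bounded s in \<open>auto intro!: AE_I2\<close>)
  qed
  finally show ?thesis by (simp only: expectation_even_time_increment[OF s])
qed

text \<open>The pathwise integral formula for powers of the even time, averaged, with expectation
  and time integral exchanged by Fubini.\<close>

lemma expectation_even_time_power_Suc:
  assumes t: "0 \<le> t"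
  shows "expectation (\<lambda>\<omega>. even_time N t \<omega> ^ Suc k * of_bool (N t \<omega> = n))
    = (LINT s:{0..t}|lborel. real (Suc k) *
        expectation (\<lambda>\<omega>. even_time N s \<omega> ^ k * of_bool (even (N s \<omega>)) * of_bool (N t \<omega> = n)))"
proof -
  \<comment> \<open>The indicator and the clamp \<open>max 0 s\<close> extend the integrand to all
    real \<open>s\<close> in a jointly measurable way; on \<open>{0..t}\<close> they change
    nothing.\<close>
  define g where "g s \<omega> = indicat_real {0..t} s *
    (real (Suc k) * (even_time N s \<omega> ^ k * of_bool (even (N (max 0 s) \<omega>)) * of_bool (N t \<omega> = n)))" for s \<omega>
  note [measurable] = borel_measurable_of_bool_N[OF t]
  have b: "(\<lambda>p. of_bool (even ((\<lambda>(u, \<omega>). N (max 0 u) \<omega>) p)) :: real) \<in> borel_measurable (borel \<Otimes>\<^sub>M M)"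
    by measurable
  have "(\<lambda>p. indicat_real {0..t} (fst p) * (real (Suc k) * ((\<lambda>(s, \<omega>). even_time N s \<omega>) p ^ k
      * of_bool (even ((\<lambda>(u, \<omega>). N (max 0 u) \<omega>) p)) * of_bool (N t (snd p) = n))))
      \<in> borel_measurable (borel \<Otimes>\<^sub>M M)"
    using b by measurable
  then have g_meas: "case_prod g \<in> borel_measurable (lborel \<Otimes>\<^sub>M M)"
    by (subst measurable_cong_sets[OF sets_pair_measure_cong[OF sets_lborel refl] refl])
       (simp add: g_def case_prod_beta')
  have M2_Times: "emeasure (lborel \<Otimes>\<^sub>M M) ({0..t} \<times> space M) = emeasure lborel {0..t} * emeasure M (space M)"
    by (rule emeasure_pair_measure_Times) auto
  interpret pair_sigma_finite lborel M ..
  have g_int: "integrable (lborel \<Otimes>\<^sub>M M) (case_prod g)"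
  proof (rule integrableI_bounded_set[where A="{0..t} \<times> space M" and B="real (Suc k) * t ^ k"])
    show "emeasure (lborel \<Otimes>\<^sub>M M) ({0..t} \<times> space M) < \<infinity>"
      using t M2_Times by (simp add: emeasure_space_1)
    show "AE p in lborel \<Otimes>\<^sub>M M. p \<in> {0..t} \<times> space M \<longrightarrow> norm (case_prod g p) \<le> real (Suc k) * t ^ k"
    proof (rule AE_I2, rule impI)
      fix p assume "p \<in> {0..t} \<times> space M"
      then obtain s \<omega> where p: "p = (s, \<omega>)" "0 \<le> s" "s \<le> t" "\<omega> \<in> space M" by auto
      have "\<bar>even_time N s \<omega> ^ k\<bar> \<le> t ^ k"
        using even_time_power_bounded[of \<omega> s k] p power_mono[of s t k] by linarith
      then have "\<bar>even_time N s \<omega> ^ k\<bar> * of_bool (even (N (max 0 s) \<omega>)) * of_bool (N t \<omega> = n) \<le> t ^ k"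
        using t by auto
      then have "real (Suc k) * (\<bar>even_time N s \<omega> ^ k\<bar> * of_bool (even (N (max 0 s) \<omega>)) * of_bool (N t \<omega> = n))
        \<le> real (Suc k) * t ^ k"
        by (intro mult_left_mono) auto
      then show "norm (case_prod g p) \<le> real (Suc k) * t ^ k"
        using p by (simp add: g_def abs_mult power_abs del: of_nat_Suc)
    qed
    show "AE p in lborel \<Otimes>\<^sub>M M. p \<notin> {0..t} \<times> space M \<longrightarrow> case_prod g p = 0"
      by (rule AE_I2) (auto simp: g_def space_pair_measure indicator_def)
    show "{0..t} \<times> space M \<in> sets (lborel \<Otimes>\<^sub>M M)"
      by (rule pair_measureI) auto
    show "case_prod g \<in> borel_measurable (lborel \<Otimes>\<^sub>M M)"
      by (rule g_meas)
  qed
  have "expectation (\<lambda>\<omega>. even_time N t \<omega> ^ Suc k * of_bool (N t \<omega> = n)) = expectation (\<lambda>\<omega>. LINT s|lborel. g s \<omega>)"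
  proof (rule Bochner_Integration.integral_cong[OF refl])
    fix \<omega> assume \<omega>: "\<omega> \<in> space M"
    have m: "(\<lambda>s. g s \<omega>) \<in> borel_measurable lborel"
      using measurable_compose[OF measurable_Pair2'[OF \<omega>] g_meas] by simp
    have "integrable lborel (\<lambda>s. g s \<omega>)"
    proof (rule integrableI_bounded_set[where A="{0..t}" and B="real (Suc k) * t ^ k"])
      show "AE s in lborel. s \<in> {0..t} \<longrightarrow> norm (g s \<omega>) \<le> real (Suc k) * t ^ k"
      proof (rule AE_I2, rule impI)
        fix s assume s: "s \<in> {0..t}"
        have "\<bar>even_time N s \<omega> ^ k\<bar> \<le> t ^ k"
          using even_time_power_bounded[of \<omega> s k] \<omega> s power_mono[of s t k] by auto
        then have "\<bar>even_time N s \<omega> ^ k\<bar> * of_bool (even (N (max 0 s) \<omega>)) * of_bool (N t \<omega> = n) \<le> t ^ k"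
          using t by auto
        then have "real (Suc k) * (\<bar>even_time N s \<omega> ^ k\<bar> * of_bool (even (N (max 0 s) \<omega>)) * of_bool (N t \<omega> = n))
          \<le> real (Suc k) * t ^ k"
          by (intro mult_left_mono) auto
        then show "norm (g s \<omega>) \<le> real (Suc k) * t ^ k"
          using s by (simp add: g_def abs_mult power_abs del: of_nat_Suc)
      qed
    qed (use m t in \<open>auto simp: g_def\<close>)
    then have si: "set_integrable lborel {0..t} (\<lambda>s. g s \<omega>)"
      unfolding set_integrable_def by (rule integrable_mult_indicator[rotated]) auto
    have "((\<lambda>s. real (Suc k) * (even_time N s \<omega> ^ k * of_bool (even (N s \<omega>))) * of_bool (N t \<omega> = n))
      has_integral even_time N t \<omega> ^ Suc k * of_bool (N t \<omega> = n)) {0..t}"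
      by (rule has_integral_mult_left[OF even_time_power_has_integral[OF \<omega> t]])
    then have "((\<lambda>s. g s \<omega>) has_integral even_time N t \<omega> ^ Suc k * of_bool (N t \<omega> = n)) {0..t}"
      by (rule has_integral_eq[rotated]) (auto simp: g_def)
    then have "even_time N t \<omega> ^ Suc k * of_bool (N t \<omega> = n) = (LINT s:{0..t}|lborel. g s \<omega>)"
      using set_borel_integral_eq_integral(2)[OF si] by (simp add: integral_unique)
    also have "\<dots> = (LINT s|lborel. g s \<omega>)"
      unfolding set_lebesgue_integral_def
      by (rule Bochner_Integration.integral_cong) (auto simp: g_def indicator_def)
    finally show "even_time N t \<omega> ^ Suc k * of_bool (N t \<omega> = n) = (LINT s|lborel. g s \<omega>)" .
  qed
  also have "\<dots> = (LINT s|lborel. expectation (g s))"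
    by (rule Fubini_integral[OF g_int])
  also have "\<dots> = (LINT s:{0..t}|lborel. real (Suc k) *
        expectation (\<lambda>\<omega>. even_time N s \<omega> ^ k * of_bool (even (N s \<omega>)) * of_bool (N t \<omega> = n)))"
    unfolding set_lebesgue_integral_def
  proof (rule Bochner_Integration.integral_cong[OF refl])
    fix s :: real
    have "g s = (\<lambda>\<omega>. (indicat_real {0..t} s * real (Suc k)) *
        (even_time N s \<omega> ^ k * of_bool (even (N s \<omega>)) * of_bool (N t \<omega> = n)))"
      by (rule ext) (auto simp: g_def indicator_def)
    then show "expectation (g s) = indicat_real {0..t} s *\<^sub>R (real (Suc k) *
        expectation (\<lambda>\<omega>. even_time N s \<omega> ^ k * of_bool (even (N s \<omega>)) * of_bool (N t \<omega> = n)))"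
      by simp
  qed
  finally show ?thesis .
qed

text \<open>For \<open>n > 0\<close> this is the probability of \<open>n\<close> events times the
  \<open>k\<close>-th moment of \<open>t\<close> times a Beta variable with parameters
  \<open>n div 2 + 1\<close> and \<open>Suc n div 2\<close>; for \<open>n = 0\<close> the even time
  is \<open>t\<close>. The induction generalises over \<open>t\<close> and \<open>n\<close>, since
  its step refers to earlier times \<open>s\<close> and to the counts \<open>2 * i\<close>.\<close>

theorem expectation_even_time_power:
  assumes "0 < rate" "0 \<le> t"
  shows "expectation (\<lambda>\<omega>. even_time N t \<omega> ^ k * of_bool (N t \<omega> = n))
    = exp (- (rate * t)) * rate ^ n * t ^ (n + k) / fact (n + k) * (fact (k + n div 2) / fact (n div 2))"
  using \<open>0 \<le> t\<close>
proof (induction k arbitrary: t n)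
  case 0
  have "expectation (\<lambda>\<omega>. even_time N t \<omega> ^ 0 * of_bool (N t \<omega> = n)) = expectation (\<lambda>\<omega>. of_bool (N t \<omega> - N 0 \<omega> = n))"
    by (rule Bochner_Integration.integral_cong) (auto simp: N_zero)
  also have "\<dots> = (rate * (t - 0)) ^ n / fact n * exp (- (rate * (t - 0)))"
    by (rule expectation_increment) (use assms 0 in auto)
  finally show ?case by (simp add: power_mult_distrib)
next
  case (Suc k)
  define C where "C = exp (- (rate * t)) * rate ^ n"
  \<comment> \<open>The exponentials and the powers of the rate from the two independent factors
    recombine to \<open>C\<close>, which depends on neither \<open>s\<close> nor \<open>i\<close>;
    what remains is a Beta integrand.\<close>
  have integrand: "expectation (\<lambda>\<omega>. even_time N s \<omega> ^ k * of_bool (even (N s \<omega>)) * of_bool (N t \<omega> = n))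
    = (\<Sum>i\<le>n div 2. C * (fact (k + i) / fact i) / (fact (2 * i + k) * fact (n - 2 * i)) * (s ^ (2 * i + k) * (t - s) ^ (n - 2 * i)))"
    if s: "0 \<le> s" "s \<le> t" for s
    unfolding expectation_even_time_even[OF s]
  proof (rule sum.cong[OF refl])
    fix i assume "i \<in> {..n div 2}"
    then have "2 * i + (n - 2 * i) = n" by auto
    then have r: "rate ^ (2 * i) * rate ^ (n - 2 * i) = rate ^ n" by (metis power_add)
    have "exp (- (rate * s)) * exp (- (rate * (t - s))) = exp (- (rate * t))"
      by (simp add: exp_add[symmetric] algebra_simps)
    then have C: "C = exp (- (rate * s)) * exp (- (rate * (t - s))) * (rate ^ (2 * i) * rate ^ (n - 2 * i))"
      by (simp add: C_def r)
    show "expectation (\<lambda>\<omega>. even_time N s \<omega> ^ k * of_bool (N s \<omega> = 2 * i)) * expectation (\<lambda>\<omega>. of_bool (N t \<omega> - N s \<omega> = n - 2 * i))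
      = C * (fact (k + i) / fact i) / (fact (2 * i + k) * fact (n - 2 * i)) * (s ^ (2 * i + k) * (t - s) ^ (n - 2 * i))"
      unfolding Suc.IH[OF s(1)] expectation_increment[OF assms(1) s] C
      by (simp add: power_mult_distrib mult_ac)
  qed
  have "((\<lambda>s. real (Suc k) * (\<Sum>i\<le>n div 2. C * (fact (k + i) / fact i) / (fact (2 * i + k) * fact (n - 2 * i))
        * (s ^ (2 * i + k) * (t - s) ^ (n - 2 * i))))
    has_integral real (Suc k) * (\<Sum>i\<le>n div 2. C * (fact (k + i) / fact i) / (fact (2 * i + k) * fact (n - 2 * i))
        * (fact (2 * i + k) * fact (n - 2 * i) / fact (2 * i + k + (n - 2 * i) + 1) * t ^ (2 * i + k + (n - 2 * i) + 1)))) {0..t}"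
    by (intro has_integral_mult_right has_integral_sum finite_atMost has_integral_Beta_nat Suc.prems)
  \<comment> \<open>Each Beta integral cancels the factorials in its own denominator, and every
    summand acquires the same power of \<open>t\<close>; only \<open>fact (k + i) / fact i\<close>
    still depends on \<open>i\<close>.\<close>
  also have "(\<Sum>i\<le>n div 2. C * (fact (k + i) / fact i) / (fact (2 * i + k) * fact (n - 2 * i))
        * (fact (2 * i + k) * fact (n - 2 * i) / fact (2 * i + k + (n - 2 * i) + 1) * t ^ (2 * i + k + (n - 2 * i) + 1)))
      = (\<Sum>i\<le>n div 2. C * t ^ (n + Suc k) / fact (n + Suc k) * (fact (k + i) / fact i))"
  proof (rule sum.cong[OF refl])
    fix i assume "i \<in> {..n div 2}"
    then have e: "2 * i + k + (n - 2 * i) + 1 = n + Suc k" by auto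
    show "C * (fact (k + i) / fact i) / (fact (2 * i + k) * fact (n - 2 * i))
        * (fact (2 * i + k) * fact (n - 2 * i) / fact (2 * i + k + (n - 2 * i) + 1) * t ^ (2 * i + k + (n - 2 * i) + 1))
      = C * t ^ (n + Suc k) / fact (n + Suc k) * (fact (k + i) / fact i)"
      unfolding e by (simp add: mult_ac del: fact_Suc power_Suc add_Suc_right)
  qed
  also have "real (Suc k) * \<dots> = C * t ^ (n + Suc k) / fact (n + Suc k) * ((\<Sum>i\<le>n div 2. fact (k + i) / fact i) * real (Suc k))"
    by (simp add: sum_distrib_left sum_distrib_right mult_ac del: fact_Suc power_Suc add_Suc_right of_nat_Suc)
  also have "(\<Sum>i\<le>n div 2. fact (k + i) / fact i) * real (Suc k) = fact (Suc k + n div 2) / fact (n div 2)"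
    by (rule sum_rising_fact_ratio)
  finally have hi: "((\<lambda>s. real (Suc k) * (\<Sum>i\<le>n div 2. C * (fact (k + i) / fact i) / (fact (2 * i + k) * fact (n - 2 * i))
        * (s ^ (2 * i + k) * (t - s) ^ (n - 2 * i))))
    has_integral C * t ^ (n + Suc k) / fact (n + Suc k) * (fact (Suc k + n div 2) / fact (n div 2))) {0..t}" .
  have "expectation (\<lambda>\<omega>. even_time N t \<omega> ^ Suc k * of_bool (N t \<omega> = n))
    = (LINT s:{0..t}|lborel. real (Suc k) * (\<Sum>i\<le>n div 2. C * (fact (k + i) / fact i) / (fact (2 * i + k) * fact (n - 2 * i))
        * (s ^ (2 * i + k) * (t - s) ^ (n - 2 * i))))"
    unfolding expectation_even_time_power_Suc[OF Suc.prems]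
    by (rule set_lebesgue_integral_cong) (simp_all add: integrand)
  also have "\<dots> = integral {0..t} (\<lambda>s. real (Suc k) * (\<Sum>i\<le>n div 2. C * (fact (k + i) / fact i) / (fact (2 * i + k) * fact (n - 2 * i))
        * (s ^ (2 * i + k) * (t - s) ^ (n - 2 * i))))"
    by (intro set_borel_integral_eq_integral(2) borel_integrable_atLeastAtMost' continuous_intros) auto
  also have "\<dots> = C * t ^ (n + Suc k) / fact (n + Suc k) * (fact (Suc k + n div 2) / fact (n div 2))"
    by (rule integral_unique[OF hi])
  finally show ?case by (simp only: C_def)
qed

text \<open>Joint with the event of \<open>Suc n\<close> jumps, not conditional on it: the mass on
  \<open>[0, t]\<close> is the probability of that event. The jumps cut \<open>[0, t]\<close> into
  \<open>n + 2\<close> pieces, and the exponents are one less than the numbers of pieces with even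
  and with odd value of \<open>N\<close>. The index starts at one jump because without jumps the
  even time has an atom at \<open>t\<close>.\<close>

definition even_time_density :: "real \<Rightarrow> nat \<Rightarrow> real \<Rightarrow> real" where
  "even_time_density t n s = exp (- (rate * t)) * rate ^ Suc n *
     (s ^ (Suc n div 2) * (t - s) ^ (n div 2)) / (fact (Suc n div 2) * fact (n div 2))"

lemma even_time_density_nonneg: "0 < rate \<Longrightarrow> s \<in> {0..t} \<Longrightarrow> 0 \<le> even_time_density t n s"
  by (simp add: even_time_density_def)

lemma continuous_on_even_time_density: "continuous_on A (even_time_density t n)"
  unfolding even_time_density_def by (intro continuous_intros) auto

lemma borel_measurable_even_time_density [measurable]: "even_time_density t n \<in> borel_measurable borel"
  by (rule borel_measurable_continuous_onI[OF continuous_on_even_time_density])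

theorem emeasure_even_time:
  assumes rate: "0 < rate" and t: "0 < t" and B: "B \<in> sets borel"
  shows "emeasure M {\<omega> \<in> space M. N t \<omega> = Suc n \<and> even_time N t \<omega> \<in> B}
    = (\<integral>\<^sup>+s. ennreal (indicator {0..t} s * even_time_density t n s) * indicator B s \<partial>lborel)"
proof -
  have t': "0 \<le> t" using t by simp
  note [measurable] = borel_measurable_of_bool_N[OF t']
  \<comment> \<open>The restriction of \<open>M\<close> to the event of \<open>Suc n\<close> jumps,
    written as a density so that integrals become expectations with an indicator. Its image under
    the even time is compared with the candidate \<open>\<nu>\<close>.\<close>
  define \<delta> where "\<delta> = density M (\<lambda>\<omega>. ennreal (of_bool (N t \<omega> = Suc n)))"
  define \<mu> where "\<mu> = distr \<delta> borel (even_time N t)"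
  define \<nu> where "\<nu> = density lborel (\<lambda>s. ennreal (indicator {0..t} s * even_time_density t n s))"
  have V: "even_time N t \<in> borel_measurable \<delta>"
    unfolding \<delta>_def by simp
  have dens_nonneg: "0 \<le> indicator {0..t} s * even_time_density t n s" for s
    using even_time_density_nonneg[OF rate] by (simp add: indicator_def)
  have \<delta>_emeasure: "emeasure \<delta> A = emeasure M (A \<inter> {\<omega> \<in> space M. N t \<omega> = Suc n})" if [measurable]: "A \<in> sets M" for A
  proof -
    have [measurable]: "Measurable.pred M (\<lambda>\<omega>. N t \<omega> = Suc n)"
      using N_measurable[OF t'] by measurable
    have "emeasure \<delta> A = (\<integral>\<^sup>+\<omega>. ennreal (of_bool (N t \<omega> = Suc n)) * indicator A \<omega> \<partial>M)"
      unfolding \<delta>_def by (rule emeasure_density) simp_all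
    also have "\<dots> = (\<integral>\<^sup>+\<omega>. indicator (A \<inter> {\<omega> \<in> space M. N t \<omega> = Suc n}) \<omega> \<partial>M)"
      by (rule nn_integral_cong) (auto simp: indicator_def)
    also have "\<dots> = emeasure M (A \<inter> {\<omega> \<in> space M. N t \<omega> = Suc n})"
      by (rule nn_integral_indicator) simp
    finally show ?thesis .
  qed
  have \<mu>_fin: "finite_borel_measure \<mu>"
  proof (intro finite_borel_measure.intro finite_borel_measure_axioms.intro finite_measureI)
    have "emeasure \<mu> (space \<mu>) = emeasure \<delta> (space M)"
      unfolding \<mu>_def using V by (subst emeasure_distr) (auto simp: \<delta>_def)
    also have "\<dots> \<noteq> \<infinity>" by (subst \<delta>_emeasure) auto
    finally show "emeasure \<mu> (space \<mu>) \<noteq> \<infinity>" .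
  qed (simp add: \<mu>_def)
  have dens_int: "integrable lborel (\<lambda>s. indicator {0..t} s * even_time_density t n s)"
    using borel_integrable_atLeastAtMost'[OF continuous_on_even_time_density[of "{0..t}" t n]]
    by (simp add: set_integrable_def)
  have \<nu>_fin: "finite_borel_measure \<nu>"
  proof (intro finite_borel_measure.intro finite_borel_measure_axioms.intro finite_measureI)
    have "emeasure \<nu> (space \<nu>) = (\<integral>\<^sup>+s. ennreal (indicator {0..t} s * even_time_density t n s) \<partial>lborel)"
      unfolding \<nu>_def by (subst emeasure_density) auto
    also have "\<dots> \<noteq> \<infinity>"
      by (subst nn_integral_eq_integral[OF dens_int]) (use dens_nonneg in auto)
    finally show "emeasure \<nu> (space \<nu>) \<noteq> \<infinity>" .
  qed (simp add: \<nu>_def)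
  have "\<mu> = \<nu>"
  proof (rule finite_borel_measure_eq_of_moments[OF \<mu>_fin \<nu>_fin])
    have "AE \<omega> in \<delta>. even_time N t \<omega> \<in> {0..t}"
      unfolding \<delta>_def using even_time_nonneg even_time_le t'
      by (subst AE_density) auto
    then show "AE x in \<mu>. x \<in> {0..t}"
      unfolding \<mu>_def using V by (subst AE_distr_iff) auto
    show "AE x in \<nu>. x \<in> {0..t}"
      unfolding \<nu>_def by (subst AE_density) (auto simp: indicator_def)
    fix k
    have "(LINT x|\<mu>. x ^ k) = (LINT \<omega>|\<delta>. even_time N t \<omega> ^ k)"
      unfolding \<mu>_def by (rule integral_distr[OF V]) simp
    also have "\<dots> = expectation (\<lambda>\<omega>. of_bool (N t \<omega> = Suc n) *\<^sub>R even_time N t \<omega> ^ k)"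
      unfolding \<delta>_def by (rule integral_density) auto
    also have "\<dots> = expectation (\<lambda>\<omega>. even_time N t \<omega> ^ k * of_bool (N t \<omega> = Suc n))"
      by (simp add: mult.commute)
    also have "\<dots> = exp (- (rate * t)) * rate ^ Suc n * t ^ (Suc n + k) / fact (Suc n + k) * (fact (k + Suc n div 2) / fact (Suc n div 2))"
      by (rule expectation_even_time_power[OF rate t'])
    also have "\<dots> = (LINT s:{0..t}|lborel. even_time_density t n s * s ^ k)"
    proof -
      define K where "K = exp (- (rate * t)) * rate ^ Suc n / (fact (Suc n div 2) * fact (n div 2))"
      have e: "Suc n div 2 + k + n div 2 + 1 = Suc n + k" by presburger
      have "((\<lambda>s. K * (s ^ (Suc n div 2 + k) * (t - s) ^ (n div 2))) has_integral
        K * (fact (Suc n div 2 + k) * fact (n div 2) / fact (Suc n div 2 + k + n div 2 + 1)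
          * t ^ (Suc n div 2 + k + n div 2 + 1))) {0..t}"
        by (intro has_integral_mult_right has_integral_Beta_nat t')
      moreover have "K * (s ^ (Suc n div 2 + k) * (t - s) ^ (n div 2)) = even_time_density t n s * s ^ k" for s
        by (simp add: K_def even_time_density_def power_add mult_ac)
      ultimately have "((\<lambda>s. even_time_density t n s * s ^ k) has_integral
        K * (fact (Suc n div 2 + k) * fact (n div 2) / fact (Suc n + k) * t ^ (Suc n + k))) {0..t}"
        by (simp only: e)
      moreover have "set_integrable lborel {0..t} (\<lambda>s. even_time_density t n s * s ^ k)"
        by (intro borel_integrable_atLeastAtMost' continuous_intros continuous_on_even_time_density)
      ultimately have "(LINT s:{0..t}|lborel. even_time_density t n s * s ^ k)
        = K * (fact (Suc n div 2 + k) * fact (n div 2) / fact (Suc n + k) * t ^ (Suc n + k))"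
        using set_borel_integral_eq_integral(2) integral_unique by metis
      then show ?thesis by (simp add: K_def mult_ac add.commute[of k] del: fact_Suc power_Suc)
    qed
    also have "\<dots> = (LINT s|lborel. (indicator {0..t} s * even_time_density t n s) *\<^sub>R s ^ k)"
      by (simp add: set_lebesgue_integral_def mult_ac)
    also have "\<dots> = (LINT x|\<nu>. x ^ k)"
      unfolding \<nu>_def by (rule integral_density[symmetric]) (use dens_nonneg in auto)
    finally show "(LINT x|\<mu>. x ^ k) = (LINT x|\<nu>. x ^ k)" .
  qed
  then have "emeasure \<mu> B = emeasure \<nu> B" by simp
  also have "emeasure \<mu> B = emeasure \<delta> (even_time N t -` B \<inter> space M)"
    unfolding \<mu>_def using V B by (subst emeasure_distr) (auto simp: \<delta>_def)
  also have "\<dots> = emeasure M (even_time N t -` B \<inter> space M \<inter> {\<omega> \<in> space M. N t \<omega> = Suc n})"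
    by (rule \<delta>_emeasure) (rule measurable_sets[OF measurable_even_time B])
  also have "even_time N t -` B \<inter> space M \<inter> {\<omega> \<in> space M. N t \<omega> = Suc n}
    = {\<omega> \<in> space M. N t \<omega> = Suc n \<and> even_time N t \<omega> \<in> B}" by auto
  also have "emeasure \<nu> B = (\<integral>\<^sup>+s. ennreal (indicator {0..t} s * even_time_density t n s) * indicator B s \<partial>lborel)"
    unfolding \<nu>_def using B by (intro emeasure_density) auto
  finally show ?thesis .
qed

end

section \<open>Almost sure properties of Poisson paths\<close>

context poisson_process
begin

lemma pred_increment:
  assumes "0 \<le> s" "0 \<le> t"
  shows "Measurable.pred M (\<lambda>\<omega>. P (N t \<omega> - N s \<omega>))"
  by (rule measurable_compose[OF measurable_increment[OF assms]]) auto

lemma prob_increment: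
  assumes "0 < rate" "0 \<le> s" "s \<le> t"
  shows "prob {\<omega> \<in> space M. N t \<omega> - N s \<omega> = l} = (rate * (t - s)) ^ l / fact l * exp (- (rate * (t - s)))"
  using expectation_increment[OF assms, of l] expectation_of_bool[OF pred_increment, of s t "\<lambda>n. n = l"] assms
  by simp

lemma prob_increment_pos_le:
  assumes "0 < rate" "0 \<le> s" "s \<le> t"
  shows "prob {\<omega> \<in> space M. 0 < N t \<omega> - N s \<omega>} \<le> rate * (t - s)"
proof -
  have "{\<omega> \<in> space M. 0 < N t \<omega> - N s \<omega>} = space M - {\<omega> \<in> space M. N t \<omega> - N s \<omega> = 0}" by auto
  then have "prob {\<omega> \<in> space M. 0 < N t \<omega> - N s \<omega>} = 1 - exp (- (rate * (t - s)))"
    using prob_increment[OF assms, of 0] pred_increment[of s t "\<lambda>n. n = 0"] assms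
    by (simp only: prob_compl[of "{\<omega> \<in> space M. N t \<omega> - N s \<omega> = 0}"] pred_def order_trans) simp
  also have "\<dots> \<le> rate * (t - s)"
    using exp_ge_add_one_self[of "- (rate * (t - s))"] by simp
  finally show ?thesis .
qed

text \<open>Follows from \<open>exp (- x) \<ge> 1 - x\<close>. The quadratic order matters: over
  \<open>m\<close> cells of length \<open>t / m\<close> the bounds still sum to order
  \<open>1 / m\<close>.\<close>

lemma prob_increment_ge_2_le:
  assumes "0 < rate" "0 \<le> s" "s \<le> t"
  shows "prob {\<omega> \<in> space M. 1 < N t \<omega> - N s \<omega>} \<le> (rate * (t - s))\<^sup>2"
proof -
  let ?x = "rate * (t - s)"
  let ?A = "\<lambda>l. {\<omega> \<in> space M. N t \<omega> - N s \<omega> = l}"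
  have A: "?A l \<in> events" for l
    using pred_increment[of s t "\<lambda>n. n = l"] assms by (simp add: pred_def)
  have "{\<omega> \<in> space M. 1 < N t \<omega> - N s \<omega>} = space M - (?A 0 \<union> ?A 1)" by auto
  then have "prob {\<omega> \<in> space M. 1 < N t \<omega> - N s \<omega>} = 1 - prob (?A 0 \<union> ?A 1)"
    by (simp only: prob_compl[OF sets.Un[OF A A]])
  also have "prob (?A 0 \<union> ?A 1) = prob (?A 0) + prob (?A 1)"
    by (rule finite_measure_Union[OF A A]) auto
  also have "\<dots> = (1 + ?x) * exp (- ?x)"
    unfolding prob_increment[OF assms] by (simp add: algebra_simps)
  also have "1 - (1 + ?x) * exp (- ?x) \<le> 1 - (1 + ?x) * (1 - ?x)"
    using exp_ge_add_one_self[of "- ?x"] assms by (intro diff_left_mono mult_left_mono) auto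
  finally show ?thesis by (simp add: algebra_simps power2_eq_square)
qed

text \<open>An exceptional path has, in every grid, a cell with increment at least two. By the union
  bound this has probability at most \<open>(rate * t)\<^sup>2 / Suc m\<close> for each
  \<open>m\<close>, hence 0.\<close>

lemma AE_unit_increments:
  assumes "0 < rate" "0 \<le> t"
  shows "AE \<omega> in M. \<exists>m. \<forall>i<Suc m. N (real (Suc i) * (t / real (Suc m))) \<omega> - N (real i * (t / real (Suc m))) \<omega> \<le> 1"
proof -
  define E where "E m i = {\<omega> \<in> space M. 1 < N (real (Suc i) * (t / real (Suc m))) \<omega> - N (real i * (t / real (Suc m))) \<omega>}" for m i
  have E: "E m i \<in> events" for m i
    using pred_increment[of "real i * (t / real (Suc m))" "real (Suc i) * (t / real (Suc m))" "\<lambda>n. 1 < n"] assms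
    unfolding E_def by (simp add: pred_def)
  have "prob (\<Inter>m. \<Union>i<Suc m. E m i) \<le> (rate * t)\<^sup>2 * inverse (real (Suc m))" for m
  proof -
    have "prob (\<Inter>m. \<Union>i<Suc m. E m i) \<le> prob (\<Union>i<Suc m. E m i)"
      using E by (intro finite_measure_mono) auto
    also have "\<dots> \<le> (\<Sum>i<Suc m. prob (E m i))"
      using E by (intro finite_measure_subadditive_finite) auto
    also have "\<dots> \<le> (\<Sum>i<Suc m. (rate * (t / real (Suc m)))\<^sup>2)"
    proof (rule sum_mono)
      fix i
      have "0 \<le> real i * (t / real (Suc m))" "real i * (t / real (Suc m)) \<le> real (Suc i) * (t / real (Suc m))"
        using assms by (auto intro!: mult_right_mono simp del: times_divide_eq_right)
      from prob_increment_ge_2_le[OF assms(1) this]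
      show "prob (E m i) \<le> (rate * (t / real (Suc m)))\<^sup>2"
        unfolding E_def by (simp add: left_diff_distrib[symmetric] del: times_divide_eq_right)
    qed
    also have "\<dots> = real (Suc m) * (rate * (t / real (Suc m)))\<^sup>2" by simp
    also have "\<dots> = (rate * t)\<^sup>2 * inverse (real (Suc m))"
      by (simp add: power2_eq_square divide_simps del: of_nat_Suc)
    finally show ?thesis .
  qed
  moreover have "(\<lambda>m. (rate * t)\<^sup>2 * inverse (real (Suc m))) \<longlonglongrightarrow> (rate * t)\<^sup>2 * 0"
    by (intro tendsto_intros LIMSEQ_inverse_real_of_nat)
  ultimately have "prob (\<Inter>m. \<Union>i<Suc m. E m i) \<le> 0"
    by (intro LIMSEQ_le_const[where a="prob _"]) auto
  then have "emeasure M (\<Inter>m. \<Union>i<Suc m. E m i) = 0"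
    by (simp add: emeasure_eq_measure measure_le_0_iff)
  then show ?thesis
    by (rule AE_I[rotated]) (use E in \<open>auto simp: E_def not_le\<close>)
qed

text \<open>A jump at \<open>t\<close> itself would count in \<open>N t\<close> without affecting
  the motion up to \<open>t\<close>. It would force a jump in each of the intervals from
  \<open>s m\<close> to \<open>t\<close>, whose probability is at most \<open>rate\<close> times
  their length.\<close>

lemma AE_constant_before:
  assumes "0 < rate" "0 < t"
  shows "AE \<omega> in M. \<exists>s. 0 \<le> s \<and> s < t \<and> N s \<omega> = N t \<omega>"
proof -
  define s where "s m = t * (1 - inverse (real (Suc m)))" for m
  have s: "0 \<le> s m" "s m < t" for m
    using assms by (auto simp: s_def mult_less_cancel_left2 inverse_le_1_iff)
  define E where "E m = {\<omega> \<in> space M. 0 < N t \<omega> - N (s m) \<omega>}" for m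
  have E: "E m \<in> events" for m
    using pred_increment[of "s m" t "\<lambda>n. 0 < n"] s assms unfolding E_def by (simp add: pred_def)
  have "prob (\<Inter>m. E m) \<le> rate * t * inverse (real (Suc m))" for m
  proof -
    have "prob (\<Inter>m. E m) \<le> prob (E m)"
      using E by (intro finite_measure_mono) auto
    also have "\<dots> \<le> rate * (t - s m)"
      unfolding E_def by (rule prob_increment_pos_le) (use assms s[of m] in auto)
    finally show ?thesis by (simp add: s_def algebra_simps)
  qed
  moreover have "(\<lambda>m. rate * t * inverse (real (Suc m))) \<longlonglongrightarrow> rate * t * 0"
    by (intro tendsto_intros LIMSEQ_inverse_real_of_nat)
  ultimately have "prob (\<Inter>m. E m) \<le> 0"
    by (intro LIMSEQ_le_const[where a="prob _"]) auto
  then have null: "emeasure M (\<Inter>m. E m) = 0"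
    by (simp add: emeasure_eq_measure measure_le_0_iff)
  show ?thesis
  proof (rule AE_I[OF _ null])
    show "{\<omega> \<in> space M. \<not> (\<exists>s. 0 \<le> s \<and> s < t \<and> N s \<omega> = N t \<omega>)} \<subseteq> (\<Inter>m. E m)"
    proof safe
      fix \<omega> m assume \<omega>: "\<omega> \<in> space M" "\<not> (\<exists>s. 0 \<le> s \<and> s < t \<and> N s \<omega> = N t \<omega>)"
      have "N (s m) \<omega> \<noteq> N t \<omega>" using \<omega>(2) s[of m] by blast
      moreover have "N (s m) \<omega> \<le> N t \<omega>" using N_mono[OF \<omega>(1) s(1), of m t] s(2)[of m] by simp
      ultimately show "\<omega> \<in> E m" using \<omega>(1) by (simp add: E_def)
    qed
  qed (use E in auto)
qed

text \<open>Ensures that each direction index up to \<open>N t\<close> is really held before time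
  \<open>t\<close>, so that the integral of the direction can detect every turn.\<close>

lemma AE_values_attained:
  assumes "0 < rate" "0 < t"
  shows "AE \<omega> in M. \<forall>k\<le>N t \<omega>. \<exists>u. 0 \<le> u \<and> u < t \<and> N u \<omega> = k"
  using AE_unit_increments[OF assms(1) less_imp_le[OF assms(2)]] AE_constant_before[OF assms] AE_space
proof eventually_elim
  case (elim \<omega>)
  then obtain m s where
    m: "\<And>i. i < Suc m \<Longrightarrow> N (real (Suc i) * (t / real (Suc m))) \<omega> - N (real i * (t / real (Suc m))) \<omega> \<le> 1"
    and s: "0 \<le> s" "s < t" "N s \<omega> = N t \<omega>" by blast
  define h where "h = t / real (Suc m)"
  have h: "0 \<le> h" "real (Suc m) * h = t" using assms by (auto simp: h_def)
  \<comment> \<open>Along a grid whose increments are at most one no value is skipped, by induction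
    over the grid points.\<close>
  have "\<forall>k\<le>N (real i * h) \<omega>. \<exists>u. 0 \<le> u \<and> u \<le> real i * h \<and> N u \<omega> = k" if "i \<le> Suc m" for i
    using that
  proof (induction i)
    case 0
    then show ?case using N_zero[of \<omega>] elim by (intro allI impI exI[of _ 0]) simp
  next
    case (Suc i)
    have le: "real i * h \<le> real (Suc i) * h" using h by (intro mult_right_mono) auto
    have inc: "N (real (Suc i) * h) \<omega> - N (real i * h) \<omega> \<le> 1" using m[of i] Suc.prems by (simp only: h_def)
    show ?case
    proof (intro allI impI)
      fix k assume k: "k \<le> N (real (Suc i) * h) \<omega>"
      show "\<exists>u. 0 \<le> u \<and> u \<le> real (Suc i) * h \<and> N u \<omega> = k"
      proof (cases "k \<le> N (real i * h) \<omega>")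
        case True
        then obtain u where "0 \<le> u" "u \<le> real i * h" "N u \<omega> = k" using Suc by auto
        then show ?thesis using le by (intro exI[of _ u]) linarith
      next
        case False
        then have "N (real (Suc i) * h) \<omega> = k" using k inc by linarith
        then show ?thesis using h(1) by (intro exI[of _ "real (Suc i) * h"]) simp
      qed
    qed
  qed
  from this[of "Suc m"] have all: "\<forall>k\<le>N t \<omega>. \<exists>u. 0 \<le> u \<and> u \<le> t \<and> N u \<omega> = k"
    unfolding h(2) by simp
  show ?case
  proof (intro allI impI)
    fix k assume "k \<le> N t \<omega>"
    then obtain u where u: "0 \<le> u" "u \<le> t" "N u \<omega> = k" using all by blast
    show "\<exists>u. 0 \<le> u \<and> u < t \<and> N u \<omega> = k"
    \<comment> \<open>A value found at \<open>t\<close> is \<open>N t \<omega>\<close>, which is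
      already taken at the earlier time \<open>s\<close>.\<close>
    proof (cases "u = t")
      case True
      then show ?thesis using s u by auto
    next
      case False
      then show ?thesis using u by auto
    qed
  qed
qed

end

text \<open>An integrand bounded by 1 reaches the full length as its integral only if it is 1 almost
  everywhere; right continuity upgrades this to every time before \<open>t\<close>, since each value
  is held on a small interval to the right.\<close>

lemma (in counting_process) integral_N_eq_length_imp:
  fixes g :: "nat \<Rightarrow> real"
  assumes \<omega>: "\<omega> \<in> space G" and g: "\<And>n. g n \<le> 1" and int: "integral {0..t} (\<lambda>u. g (N u \<omega>)) = t"
    and u: "0 \<le> u" "u < t"
  shows "g (N u \<omega>) = 1"
proof -
  obtain e where e: "u < e" "\<And>s. u \<le> s \<Longrightarrow> s < e \<Longrightarrow> N s \<omega> = N u \<omega>"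
    using constant_right_N[OF \<omega> u(1)] by blast
  \<comment> \<open>The midpoint lies before both \<open>e\<close> and \<open>t\<close>, so
    \<open>{u..v}\<close> is inside the interval of constancy and inside
    \<open>{0..t}\<close>.\<close>
  define v where "v = (u + min e t) / 2"
  have v: "u < v" "v < e" "v < t" using e(1) u(2) by (auto simp: v_def)
  have i: "(\<lambda>s. 1 - g (N s \<omega>)) integrable_on {a..b}" if "0 \<le> a" for a b
    by (rule integrable_on_N_subinterval[OF \<omega> that])
  have "integral {u..v} (\<lambda>s. 1 - g (N s \<omega>)) \<le> integral {0..t} (\<lambda>s. 1 - g (N s \<omega>))"
    by (rule integral_subset_le) (use u v g i in auto)
  also have "\<dots> = integral {0..t} (\<lambda>s. 1) - integral {0..t} (\<lambda>s. g (N s \<omega>))"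
    by (rule Henstock_Kurzweil_Integration.integral_diff) (auto intro: integrable_on_N[OF \<omega>])
  also have "\<dots> = 0" using int u by simp
  also have "integral {u..v} (\<lambda>s. 1 - g (N s \<omega>)) = integral {u..v} (\<lambda>s. 1 - g (N u \<omega>))"
  proof (rule integral_cong)
    fix s assume "s \<in> {u..v}"
    then have "N s \<omega> = N u \<omega>" using v by (intro e(2)) auto
    then show "1 - g (N s \<omega>) = 1 - g (N u \<omega>)" by simp
  qed
  also have "\<dots> = (v - u) * (1 - g (N u \<omega>))" using v by simp
  finally have "1 - g (N u \<omega>) \<le> 0" using v by (simp add: mult_le_0_iff)
  with g[of "N u \<omega>"] show ?thesis by simp
qed

section \<open>Motion along the edge\<close>

lemma has_integral_Pair:
  assumes "(f has_integral a) S" "(g has_integral b) S"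
  shows "((\<lambda>x. (f x, g x)) has_integral (a, b)) S"
proof -
  have "bounded_linear (\<lambda>a. (a, 0))" "bounded_linear (\<lambda>b. (0, b))"
    by (intro bounded_linear_Pair bounded_linear_ident bounded_linear_zero)+
  from has_integral_add[OF has_integral_linear[OF assms(1) this(1)] has_integral_linear[OF assms(2) this(2)]]
  show ?thesis by (simp add: comp_def)
qed

lemma dir_mod_4:
  "dir j = (if j mod 4 = 0 then (1, 0) else if j mod 4 = 1 then (0, 1)
     else if j mod 4 = 2 then (-1, 0) else (0, -1))"
proof -
  define k where "k = j div 4"
  define r where "r = j mod 4"
  have j: "j = 4 * k + r" by (simp add: k_def r_def)
  have a: "pi * of_int j / 2 = pi * of_int r / 2 + of_int k * (2 * pi)"
    unfolding j by (simp add: field_simps)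
  have "dir j = (cos (pi * of_int r / 2), sin (pi * of_int r / 2))"
    unfolding dir_def a by (simp add: sin_add cos_add mult.commute[of _ "2 * pi"] sin_int_2pin cos_int_2pin)
  moreover have "r \<in> {0, 1, 2, 3}"
    using pos_mod_bound[of 4 j] pos_mod_sign[of 4 j] unfolding r_def by auto
  moreover have "cos (pi * 3 / 2) = 0" "sin (pi * 3 / 2) = -1"
    using cos_3over2_pi sin_3over2_pi by (simp_all add: mult.commute)
  ultimately show ?thesis
    unfolding r_def[symmetric] by auto
qed

text \<open>In the coordinates \<open>x + y\<close> and \<open>x - y\<close> the four directions are
  the four sign pairs; staying on the edge means that the first sign is always positive.\<close>

lemma fst_snd_dir_cases:
  "fst (dir j) + snd (dir j) = (if j mod 4 \<in> {0, 1} then 1 else -1)"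
  "fst (dir j) - snd (dir j) = (if j mod 4 \<in> {0, 3} then 1 else -1)"
proof -
  have "j mod 4 \<in> {0, 1, 2, 3}"
    using pos_mod_bound[of 4 j] pos_mod_sign[of 4 j] by auto
  then show "fst (dir j) + snd (dir j) = (if j mod 4 \<in> {0, 1} then 1 else -1)"
    "fst (dir j) - snd (dir j) = (if j mod 4 \<in> {0, 3} then 1 else -1)"
    by (auto simp: dir_mod_4)
qed

context orthogonal_motion
begin

text \<open>Indexed by the number of events instead of time, so that the direction at time
  \<open>u\<close> is an outcome-dependent function of \<open>N u\<close>, as
  \<open>measurable_integral_N\<close> expects.\<close>

definition orientation :: "nat \<Rightarrow> 'a \<Rightarrow> int" where
  "orientation n \<omega> = J \<omega> + (\<Sum>k<n. T k \<omega>)"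

lemma position_components:
  assumes \<omega>: "\<omega> \<in> space M"
  shows "fst (position c N J T t \<omega>) + snd (position c N J T t \<omega>)
      = c * integral {0..t} (\<lambda>u. fst (dir (orientation (N u \<omega>) \<omega>)) + snd (dir (orientation (N u \<omega>) \<omega>)))"
    and "fst (position c N J T t \<omega>) - snd (position c N J T t \<omega>)
      = c * integral {0..t} (\<lambda>u. fst (dir (orientation (N u \<omega>) \<omega>)) - snd (dir (orientation (N u \<omega>) \<omega>)))"
proof -
  let ?f = "\<lambda>u. fst (dir (orientation (N u \<omega>) \<omega>))" and ?g = "\<lambda>u. snd (dir (orientation (N u \<omega>) \<omega>))"
  have f: "?f integrable_on {0..t}"
    by (rule integrable_on_N[OF \<omega>, of "\<lambda>n. fst (dir (orientation n \<omega>))"])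
  have g: "?g integrable_on {0..t}"
    by (rule integrable_on_N[OF \<omega>, of "\<lambda>n. snd (dir (orientation n \<omega>))"])
  have "((\<lambda>u. (?f u, ?g u)) has_integral (integral {0..t} ?f, integral {0..t} ?g)) {0..t}"
    by (intro has_integral_Pair integrable_integral f g)
  then have "position c N J T t \<omega> = c *\<^sub>R (integral {0..t} ?f, integral {0..t} ?g)"
    unfolding position_def direction_def orientation_def by (simp add: integral_unique)
  then show "fst (position c N J T t \<omega>) + snd (position c N J T t \<omega>) = c * integral {0..t} (\<lambda>u. ?f u + ?g u)"
    and "fst (position c N J T t \<omega>) - snd (position c N J T t \<omega>) = c * integral {0..t} (\<lambda>u. ?f u - ?g u)"
    by (simp_all add: Henstock_Kurzweil_Integration.integral_add[OF f g]
        Henstock_Kurzweil_Integration.integral_diff[OF f g] algebra_simps)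
qed

section \<open>Measurability and support of the turns; measurability of the position\<close>

lemma measurable_J: "J \<in> M \<rightarrow>\<^sub>M count_space UNIV"
  and measurable_T: "T k \<in> M \<rightarrow>\<^sub>M count_space UNIV"
proof -
  have "(case i of 0 \<Rightarrow> J | Suc k \<Rightarrow> T k) \<in> M \<rightarrow>\<^sub>M count_space UNIV" for i
    using J_T_independent unfolding indep_vars_def by auto
  from this[of 0] this[of "Suc k"] show "J \<in> M \<rightarrow>\<^sub>M count_space UNIV" "T k \<in> M \<rightarrow>\<^sub>M count_space UNIV"
    by simp_all
qed

lemma measurable_orientation: "orientation n \<in> M \<rightarrow>\<^sub>M count_space UNIV"
proof (induction n)
  case 0
  then show ?case using measurable_J by (simp add: orientation_def[abs_def])
next
  case (Suc n)
  have "(\<lambda>\<omega>. (orientation n \<omega>, T n \<omega>)) \<in> M \<rightarrow>\<^sub>M count_space UNIV \<Otimes>\<^sub>M count_space UNIV"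
    using Suc measurable_T by (intro measurable_Pair) auto
  then have "(\<lambda>\<omega>. (orientation n \<omega>, T n \<omega>)) \<in> M \<rightarrow>\<^sub>M count_space (UNIV :: (int \<times> int) set)"
    by (simp add: pair_measure_countable)
  from measurable_compose[OF this, of "\<lambda>(i, j). i + j" "count_space UNIV"] show ?case
    by (simp add: orientation_def[abs_def] add.assoc)
qed

lemma borel_measurable_position:
  "(\<lambda>\<omega>. fst (position c N J T t \<omega>) + snd (position c N J T t \<omega>)) \<in> borel_measurable M"
  "(\<lambda>\<omega>. fst (position c N J T t \<omega>) - snd (position c N J T t \<omega>)) \<in> borel_measurable M"
proof -
  have *: "(\<lambda>\<omega>. c * integral {0..t} (\<lambda>u. h (orientation (N u \<omega>) \<omega>))) \<in> borel_measurable M" for h :: "int \<Rightarrow> real"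
  proof -
    have "(\<lambda>\<omega>. h (orientation n \<omega>)) \<in> borel_measurable M" for n
      by (rule measurable_compose[OF measurable_orientation]) simp
    from measurable_compose[OF measurable_Pair1' measurable_integral_N[OF this], of t]
    show ?thesis by simp
  qed
  show "(\<lambda>\<omega>. fst (position c N J T t \<omega>) + snd (position c N J T t \<omega>)) \<in> borel_measurable M"
    using *[of "\<lambda>j. fst (dir j) + snd (dir j)"] position_components(1)
    by (subst measurable_cong[of M]) auto
  show "(\<lambda>\<omega>. fst (position c N J T t \<omega>) - snd (position c N J T t \<omega>)) \<in> borel_measurable M"
    using *[of "\<lambda>j. fst (dir j) - snd (dir j)"] position_components(2)
    by (subst measurable_cong[of M]) auto
qed

lemma AE_J: "AE \<omega> in M. J \<omega> \<in> {0..3}"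
proof -
  have ev: "{\<omega> \<in> space M. J \<omega> = j} \<in> events" for j
    using measurable_sets[OF measurable_J, of "{j}"] by (simp add: vimage_def Int_def conj_commute)
  have "{\<omega> \<in> space M. J \<omega> \<in> {0..3}} = (\<Union>j\<in>{0..3}. {\<omega> \<in> space M. J \<omega> = j})" by auto
  then have "prob {\<omega> \<in> space M. J \<omega> \<in> {0..3}} = (\<Sum>j\<in>{0..3}. prob {\<omega> \<in> space M. J \<omega> = j})"
    using ev by (simp only:) (intro finite_measure_finite_Union, auto simp: disjoint_family_on_def)
  also have "\<dots> = (\<Sum>j\<in>{0..3::int}. 1 / 4)"
    using J_uniform by (intro sum.cong) auto
  also have "\<dots> = 1" by simp
  finally have "prob {\<omega> \<in> space M. J \<omega> \<in> {0..3}} = 1" .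
  from prob_Collect_eq_1[THEN iffD1, OF _ this] show ?thesis
    using measurable_sets[OF measurable_J, of "{0..3}"] by (simp add: vimage_def Int_def conj_commute)
qed

lemma AE_T: "AE \<omega> in M. T k \<omega> \<in> {1, -1, 2}"
proof -
  have ev: "{\<omega> \<in> space M. T k \<omega> = j} \<in> events" for j
    using measurable_sets[OF measurable_T, of "{j}"] by (simp add: vimage_def Int_def conj_commute)
  have "{\<omega> \<in> space M. T k \<omega> \<in> {1, -1, 2}} = (\<Union>j\<in>{1, -1, 2}. {\<omega> \<in> space M. T k \<omega> = j})" by auto
  then have "prob {\<omega> \<in> space M. T k \<omega> \<in> {1, -1, 2}} = (\<Sum>j\<in>{1, -1, 2}. prob {\<omega> \<in> space M. T k \<omega> = j})"
    using ev by (simp only:) (intro finite_measure_finite_Union, auto simp: disjoint_family_on_def)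
  also have "\<dots> = 1" by (simp add: T_counterclockwise T_clockwise T_reflection)
  finally have "prob {\<omega> \<in> space M. T k \<omega> \<in> {1, -1, 2}} = 1" .
  from prob_Collect_eq_1[THEN iffD1, OF _ this] show ?thesis
    using measurable_sets[OF measurable_T, of "{1, -1, 2}"] by (simp add: vimage_def Int_def conj_commute)
qed

end

section \<open>Turn sequences that keep the motion on the edge\<close>

lemma alternating_partial_sum:
  fixes \<sigma> :: "nat \<Rightarrow> int"
  assumes "\<And>k. k < n \<Longrightarrow> \<sigma> k = s * (-1) ^ k"
  shows "(\<Sum>k<n. \<sigma> k) = (if even n then 0 else s)"
  using assms by (induction n) auto

text \<open>Among the admissible turns, the only one that keeps the direction in
  \<open>{d\<^sub>0, d\<^sub>1}\<close> is the one that exchanges the two.\<close>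

lemma stays_on_edge_iff:
  fixes \<sigma> :: "nat \<Rightarrow> int"
  assumes j: "j \<in> {0..3}" and \<sigma>: "\<And>k. \<sigma> k \<in> {1, -1, 2}"
  shows "(\<forall>n\<le>m. (j + (\<Sum>k<n. \<sigma> k)) mod 4 \<in> {0, 1}) \<longleftrightarrow>
    (j = 0 \<and> (\<forall>k<m. \<sigma> k = (-1) ^ k)) \<or> (j = 1 \<and> (\<forall>k<m. \<sigma> k = - ((-1) ^ k)))"
proof (induction m)
  case 0
  from j have "j = 0 \<or> j = 1 \<or> j = 2 \<or> j = 3" by auto
  then show ?case by auto
next
  case (Suc m)
  let ?Z = "\<lambda>n. j + (\<Sum>k<n. \<sigma> k)"
  let ?E = "\<lambda>m. (j = 0 \<and> (\<forall>k<m. \<sigma> k = (-1) ^ k)) \<or> (j = 1 \<and> (\<forall>k<m. \<sigma> k = - ((-1) ^ k)))"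
  have "(\<forall>n\<le>Suc m. ?Z n mod 4 \<in> {0, 1}) \<longleftrightarrow> ?E m \<and> (?Z m + \<sigma> m) mod 4 \<in> {0, 1}"
    unfolding Suc[symmetric] by (auto simp: le_Suc_eq add.assoc)
  also have "\<dots> \<longleftrightarrow> ?E (Suc m)"
  proof -
    have conj_iff: "C \<and> B \<longleftrightarrow> A" if "A \<longleftrightarrow> X" "B \<longleftrightarrow> X" "C" for A B C X
      using that by simp
    show ?thesis
    \<comment> \<open>Along an alternating sequence the orientation before the last turn is known,
      so only the three admissible values of that turn remain to be checked.\<close>
    proof (cases "?E m")
      case True
      then consider "j = 0" "\<And>k. k < m \<Longrightarrow> \<sigma> k = 1 * (-1) ^ k" | "j = 1" "\<And>k. k < m \<Longrightarrow> \<sigma> k = - 1 * (-1) ^ k"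
        by auto
      then show ?thesis
      proof cases
        case 1
        from 1(1) alternating_partial_sum[OF 1(2)] have Z: "?Z m = (if even m then 0 else 1)" by simp
        have "?E (Suc m) \<longleftrightarrow> \<sigma> m = (-1) ^ m" using 1 by (auto simp: less_Suc_eq)
        moreover have "(?Z m + \<sigma> m) mod 4 \<in> {0, 1} \<longleftrightarrow> \<sigma> m = (-1) ^ m"
          unfolding Z using \<sigma>[of m] by (cases "even m") auto
        ultimately show ?thesis using True by (rule conj_iff)
      next
        case 2
        from 2(1) alternating_partial_sum[OF 2(2)] have Z: "?Z m = (if even m then 1 else 0)" by simp
        have "?E (Suc m) \<longleftrightarrow> \<sigma> m = - ((-1) ^ m)" using 2 by (auto simp: less_Suc_eq)
        moreover have "(?Z m + \<sigma> m) mod 4 \<in> {0, 1} \<longleftrightarrow> \<sigma> m = - ((-1) ^ m)"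
          unfolding Z using \<sigma>[of m] by (cases "even m") auto
        ultimately show ?thesis using True by (rule conj_iff)
      qed
    next
      case False
      then show ?thesis by (auto simp: less_Suc_eq)
    qed
  qed
  finally show ?case .
qed

context orthogonal_motion
begin

text \<open>The value \<open>c * t\<close> is the maximum of X + Y, reached only if one of the two
  edge directions is held at every time before \<open>t\<close>. Almost surely every index up to
  \<open>N t\<close> is held at some such time, so this becomes a condition on all turns counted by
  \<open>N t\<close>. Starting in the other edge direction exchanges even and odd counts, whence the
  sign in the second alternative.\<close>

theorem AE_edge_iff:
  assumes rate: "0 < rate" and t: "0 < t" and c: "0 < c"
  shows "AE \<omega> in M.
    fst (position c N J T t \<omega>) + snd (position c N J T t \<omega>) = c * t \<and>
    fst (position c N J T t \<omega>) - snd (position c N J T t \<omega>) \<in> A \<longleftrightarrow>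
    J \<omega> = 0 \<and> (\<forall>k<N t \<omega>. T k \<omega> = (-1) ^ k) \<and> c * (2 * even_time N t \<omega> - t) \<in> A \<or>
    J \<omega> = 1 \<and> (\<forall>k<N t \<omega>. T k \<omega> = - ((-1) ^ k)) \<and> - (c * (2 * even_time N t \<omega> - t)) \<in> A"
proof -
  have "AE \<omega> in M. \<forall>k. T k \<omega> \<in> {1, -1, 2}"
    unfolding AE_all_countable using AE_T by blast
  with AE_J AE_values_attained[OF rate t] AE_space show ?thesis
  proof eventually_elim
    case (elim \<omega>)
    note \<omega> = \<open>\<omega> \<in> space M\<close>
    let ?Z = "\<lambda>n. orientation n \<omega>"
    let ?P = "\<lambda>n. fst (dir (?Z n)) + snd (dir (?Z n))" and ?Q = "\<lambda>n. fst (dir (?Z n)) - snd (dir (?Z n))"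
    let ?E0 = "J \<omega> = 0 \<and> (\<forall>k<N t \<omega>. T k \<omega> = (-1) ^ k)"
    let ?E1 = "J \<omega> = 1 \<and> (\<forall>k<N t \<omega>. T k \<omega> = - ((-1) ^ k))"
    have N_le: "N u \<omega> \<le> N t \<omega>" if "u \<in> {0..t}" for u
      using N_mono[OF \<omega>, of u t] that by auto
    have P_int: "integral {0..t} (\<lambda>u. ?P (N u \<omega>)) = t \<longleftrightarrow> (\<forall>n\<le>N t \<omega>. ?Z n mod 4 \<in> {0, 1})"
    proof
      assume int: "integral {0..t} (\<lambda>u. ?P (N u \<omega>)) = t"
      show "\<forall>n\<le>N t \<omega>. ?Z n mod 4 \<in> {0, 1}"
      proof (intro allI impI)
        fix n assume "n \<le> N t \<omega>"
        then obtain u where u: "0 \<le> u" "u < t" "N u \<omega> = n" using elim by blast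
        have "?P (N u \<omega>) = 1"
          by (rule integral_N_eq_length_imp[OF \<omega> _ int u(1,2)]) (simp add: fst_snd_dir_cases)
        then show "?Z n mod 4 \<in> {0, 1}"
          unfolding u(3) fst_snd_dir_cases by (simp split: if_splits)
      qed
    next
      assume all: "\<forall>n\<le>N t \<omega>. ?Z n mod 4 \<in> {0, 1}"
      have "integral {0..t} (\<lambda>u. ?P (N u \<omega>)) = integral {0..t} (\<lambda>_. 1)"
      proof (rule integral_cong)
        fix u assume "u \<in> {0..t}"
        then have "?Z (N u \<omega>) mod 4 \<in> {0, 1}" using all N_le by blast
        then show "?P (N u \<omega>) = 1" unfolding fst_snd_dir_cases by simp
      qed
      then show "integral {0..t} (\<lambda>u. ?P (N u \<omega>)) = t" using t by simp
    qed
    have edge: "fst (position c N J T t \<omega>) + snd (position c N J T t \<omega>) = c * t \<longleftrightarrow> ?E0 \<or> ?E1"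
      unfolding position_components(1)[OF \<omega>] using c P_int stays_on_edge_iff[of "J \<omega>" "\<lambda>k. T k \<omega>" "N t \<omega>"] elim
      by (simp add: orientation_def)
    have V: "integral {0..t} (\<lambda>u. s * (2 * of_bool (even (N u \<omega>)) - 1)) = s * (2 * even_time N t \<omega> - t)" for s
    proof (rule integral_unique)
      have "((\<lambda>u. of_bool (even (N u \<omega>))) has_integral even_time N t \<omega>) {0..t}"
        unfolding even_time_def by (rule integrable_integral[OF integrable_on_N[OF \<omega>]])
      moreover have "((\<lambda>_. 1) has_integral t) {0..t}"
        using has_integral_const_real[of "1::real" 0 t] t by simp
      ultimately show "((\<lambda>u. s * (2 * of_bool (even (N u \<omega>)) - 1)) has_integral s * (2 * even_time N t \<omega> - t)) {0..t}"
        by (intro has_integral_mult_right has_integral_diff)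
    qed
    have Q: "integral {0..t} (\<lambda>u. ?Q (N u \<omega>)) = s * (2 * even_time N t \<omega> - t)"
      if "\<And>n. n \<le> N t \<omega> \<Longrightarrow> ?Q n = s * (2 * of_bool (even n) - 1)" for s
      unfolding V[symmetric] by (rule integral_cong) (use that N_le in blast)
    have Q0: "integral {0..t} (\<lambda>u. ?Q (N u \<omega>)) = 2 * even_time N t \<omega> - t" if ?E0
    proof -
      have "?Q n = 1 * (2 * of_bool (even n) - 1)" if "n \<le> N t \<omega>" for n
      proof -
        have "?Z n = (if even n then 0 else 1)"
          unfolding orientation_def using \<open>?E0\<close> that by (subst alternating_partial_sum[where s=1]) auto
        then show ?thesis unfolding fst_snd_dir_cases by simp
      qed
      from Q[OF this] show ?thesis by simp
    qed
    have Q1: "integral {0..t} (\<lambda>u. ?Q (N u \<omega>)) = - (2 * even_time N t \<omega> - t)" if ?E1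
    proof -
      have "?Q n = - 1 * (2 * of_bool (even n) - 1)" if "n \<le> N t \<omega>" for n
      proof -
        have "?Z n = (if even n then 1 else 0)"
          unfolding orientation_def using \<open>?E1\<close> that by (subst alternating_partial_sum[where s="-1"]) auto
        then show ?thesis unfolding fst_snd_dir_cases by simp
      qed
      from Q[OF this] show ?thesis by simp
    qed
    show ?case
      unfolding edge position_components(2)[OF \<omega>]
    proof -
      have conj_iff: "(a0 \<and> b0 \<or> a1 \<and> b1) \<and> z \<in> A \<longleftrightarrow> a0 \<and> b0 \<and> x \<in> A \<or> a1 \<and> b1 \<and> y \<in> A"
        if "a0 \<and> b0 \<Longrightarrow> z = x" "a1 \<and> b1 \<Longrightarrow> z = y" for a0 b0 a1 b1 x y z
        using that by blast
      have "c * integral {0..t} (\<lambda>u. ?Q (N u \<omega>)) = c * (2 * even_time N t \<omega> - t)" if ?E0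
        by (simp only: Q0[OF that])
      moreover have "c * integral {0..t} (\<lambda>u. ?Q (N u \<omega>)) = - (c * (2 * even_time N t \<omega> - t))" if ?E1
        by (simp only: Q1[OF that] mult_minus_right)
      ultimately show "(?E0 \<or> ?E1) \<and> c * integral {0..t} (\<lambda>u. ?Q (N u \<omega>)) \<in> A \<longleftrightarrow>
        J \<omega> = 0 \<and> (\<forall>k<N t \<omega>. T k \<omega> = (-1) ^ k) \<and> c * (2 * even_time N t \<omega> - t) \<in> A \<or>
        J \<omega> = 1 \<and> (\<forall>k<N t \<omega>. T k \<omega> = - ((-1) ^ k)) \<and> - (c * (2 * even_time N t \<omega> - t)) \<in> A"
        by (rule conj_iff)
    qed
  qed
qed

text \<open>The axiom \<open>N_J_T_independent\<close> speaks of the sigma-algebra generated by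
  \<open>N\<close>; this instance makes the even time measurable for it.\<close>

lemma counting_process_vimage_algebra:
  "counting_process (vimage_algebra (space M) (\<lambda>\<omega>. \<lambda>t\<in>{0..}. N t \<omega>) (PiM {0..} (\<lambda>_. count_space UNIV))) N"
    (is "counting_process ?G N")
proof
  fix t :: real assume t: "0 \<le> t"
  have "(\<lambda>\<omega>. \<lambda>t\<in>{0..}. N t \<omega>) \<in> ?G \<rightarrow>\<^sub>M PiM {0..} (\<lambda>_. count_space UNIV)"
    by (rule measurable_vimage_algebra1) (auto simp: space_PiM)
  from measurable_compose[OF this measurable_component_singleton[of t]] t
  show "N t \<in> ?G \<rightarrow>\<^sub>M count_space UNIV" by simp
qed (auto simp: N_mono N_right_continuous)

text \<open>With the number of events fixed to \<open>n\<close>, the turns involved are a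
  deterministic number, and both levels of independence apply: of the path from the turns, and of
  the turns from one another.\<close>

lemma emeasure_N_turns:
  fixes n :: nat and j :: int and \<sigma> :: "nat \<Rightarrow> int"
  assumes t: "0 \<le> t" and B: "B \<in> sets borel"
  defines "S \<equiv> {\<omega> \<in> space M. N t \<omega> = n \<and> even_time N t \<omega> \<in> B \<and> J \<omega> = j \<and> (\<forall>k<n. T k \<omega> = \<sigma> k)}"
  shows "S \<in> events"
    and "emeasure M S = emeasure M {\<omega> \<in> space M. N t \<omega> = n \<and> even_time N t \<omega> \<in> B} *
      ennreal (prob {\<omega> \<in> space M. J \<omega> = j} * (\<Prod>k<n. prob {\<omega> \<in> space M. T k \<omega> = \<sigma> k}))"
proof -
  let ?G = "vimage_algebra (space M) (\<lambda>\<omega>. \<lambda>t\<in>{0..}. N t \<omega>) (PiM {0..} (\<lambda>_. count_space UNIV))"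
  let ?X = "\<lambda>\<omega> i. case i of 0 \<Rightarrow> J \<omega> | Suc k \<Rightarrow> T k \<omega>"
  let ?H = "vimage_algebra (space M) ?X (PiM UNIV (\<lambda>_. count_space UNIV))"
  let ?F1 = "{\<omega> \<in> space M. N t \<omega> = n \<and> even_time N t \<omega> \<in> B}"
  let ?F2 = "{\<omega> \<in> space M. J \<omega> = j \<and> (\<forall>k<n. T k \<omega> = \<sigma> k)}"
  interpret G: counting_process ?G N by (rule counting_process_vimage_algebra)
  have "N t -` {n} \<inter> space ?G \<inter> (even_time N t -` B \<inter> space ?G) \<in> sets ?G"
    by (intro sets.Int measurable_sets[OF G.measurable_N[OF t]] measurable_sets[OF G.measurable_even_time B]) simp
  also have "N t -` {n} \<inter> space ?G \<inter> (even_time N t -` B \<inter> space ?G) = ?F1" by auto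
  finally have F1: "?F1 \<in> sets ?G" .
  \<comment> \<open>Coordinate 0 carries \<open>J\<close> and coordinate \<open>Suc k\<close>
    carries \<open>T k\<close>, so \<open>n\<close> turns together with \<open>J\<close> occupy the
    indices \<open>{..n}\<close>.\<close>
  define A where "A i = {case i of 0 \<Rightarrow> j | Suc k \<Rightarrow> \<sigma> k}" for i
  have F2_eq: "?F2 = (\<Inter>i\<in>{..n}. (\<lambda>\<omega>. ?X \<omega> i) -` A i \<inter> space M)"
    by (auto simp: A_def split: nat.splits)
  have "?X \<in> ?H \<rightarrow>\<^sub>M PiM UNIV (\<lambda>_. count_space UNIV)"
    by (rule measurable_vimage_algebra1) (auto simp: space_PiM)
  from measurable_compose[OF this measurable_component_singleton]
  have X: "(\<lambda>\<omega>. ?X \<omega> i) \<in> ?H \<rightarrow>\<^sub>M count_space UNIV" for i by simp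
  have "(\<Inter>i\<in>{..n}. (\<lambda>\<omega>. ?X \<omega> i) -` A i \<inter> space ?H) \<in> sets ?H"
    by (intro sets.finite_INT measurable_sets[OF X]) auto
  then have F2: "?F2 \<in> sets ?H" unfolding F2_eq by simp
  have ev: "?F1 \<in> events" "?F2 \<in> events"
    using indep_setD_ev1[OF N_J_T_independent] indep_setD_ev2[OF N_J_T_independent] F1 F2 by auto
  have S: "S = ?F1 \<inter> ?F2" by (auto simp: S_def)
  show "S \<in> events" unfolding S using ev by auto
  have "indep_vars (\<lambda>_. count_space UNIV) (\<lambda>i \<omega>. ?X \<omega> i) UNIV"
    using J_T_independent by (rule indep_vars_cong[THEN iffD1, rotated 3]) (auto split: nat.splits)
  from indep_varsD[OF this, of "{..n}" A]
  have "prob ?F2 = (\<Prod>i\<le>n. prob ((\<lambda>\<omega>. ?X \<omega> i) -` A i \<inter> space M))"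
    unfolding F2_eq by simp
  also have "\<dots> = prob ((\<lambda>\<omega>. ?X \<omega> 0) -` A 0 \<inter> space M) * (\<Prod>k<n. prob ((\<lambda>\<omega>. ?X \<omega> (Suc k)) -` A (Suc k) \<inter> space M))"
    by (rule prod.atMost_shift)
  also have "\<dots> = prob {\<omega> \<in> space M. J \<omega> = j} * (\<Prod>k<n. prob {\<omega> \<in> space M. T k \<omega> = \<sigma> k})"
    by (simp add: A_def vimage_def Int_def conj_commute)
  finally have "prob S = prob ?F1 * (prob {\<omega> \<in> space M. J \<omega> = j} * (\<Prod>k<n. prob {\<omega> \<in> space M. T k \<omega> = \<sigma> k}))"
    unfolding S using indep_setD[OF N_J_T_independent F1 F2] by simp
  then show "emeasure M S = emeasure M ?F1 *
      ennreal (prob {\<omega> \<in> space M. J \<omega> = j} * (\<Prod>k<n. prob {\<omega> \<in> space M. T k \<omega> = \<sigma> k}))"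
    by (simp add: emeasure_eq_measure ennreal_mult prod_nonneg)
qed

end

lemma prod_alternating:
  fixes a b :: "'b::comm_monoid_mult"
  shows "(\<Prod>k<n. if even k then a else b) = a ^ (Suc n div 2) * b ^ (n div 2)"
proof (induction n)
  case (Suc n)
  show ?case unfolding prod.lessThan_Suc Suc by (cases "even n") (auto simp: mult_ac elim!: evenE oddE)
qed simp

section \<open>The Bessel series\<close>

lemma summable_inverse_fact_squared: "summable (\<lambda>k. z ^ k / (fact k)\<^sup>2 :: real)"
proof (rule summable_comparison_test[OF _ summable_exp[of "\<bar>z\<bar>"]])
  have "norm (z ^ k / (fact k)\<^sup>2) \<le> inverse (fact k) * \<bar>z\<bar> ^ k" for k
  proof -
    have "1 * fact k \<le> (fact k :: real) * fact k" by (intro mult_right_mono fact_ge_1) simp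
    then have "\<bar>z\<bar> ^ k / (fact k)\<^sup>2 \<le> \<bar>z\<bar> ^ k / fact k"
      by (intro divide_left_mono) (auto simp: power2_eq_square)
    then show ?thesis by (simp add: abs_mult power_abs divide_inverse mult.commute)
  qed
  then show "\<exists>N. \<forall>k\<ge>N. norm (z ^ k / (fact k)\<^sup>2) \<le> inverse (fact k) * \<bar>z\<bar> ^ k" by blast
qed

text \<open>The entire function whose value at \<open>x\<^sup>2 / 4\<close> is
  \<open>bessel_I 0 x\<close>. Working with it removes the square roots from the formula.\<close>

definition bessel_series :: "real \<Rightarrow> real" where
  "bessel_series z = (\<Sum>k. z ^ k / (fact k)\<^sup>2)"

text \<open>The derivative of \<open>bessel_series\<close>; for \<open>z > 0\<close> it equals
  \<open>bessel_I 1 (2 * sqrt z) / sqrt z\<close>.\<close>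

definition bessel_series' :: "real \<Rightarrow> real" where
  "bessel_series' z = (\<Sum>k. z ^ k / (fact (Suc k) * fact k))"

lemma diffs_inverse_fact_squared: "diffs (\<lambda>k. 1 / (fact k)\<^sup>2) k = (1 / (fact (Suc k) * fact k) :: real)"
  by (simp add: diffs_def power2_eq_square del: of_nat_Suc)

lemma DERIV_bessel_series: "(bessel_series has_real_derivative bessel_series' z) (at z)"
  using termdiffs_strong_converges_everywhere[of "\<lambda>k. 1 / (fact k)\<^sup>2" z] summable_inverse_fact_squared
  by (simp add: bessel_series_def[abs_def] bessel_series'_def diffs_inverse_fact_squared)

lemma summable_bessel_series': "summable (\<lambda>k. z ^ k / (fact (Suc k) * fact k) :: real)"
  using termdiff_converges_all[of "\<lambda>k. 1 / (fact k)\<^sup>2" z] summable_inverse_fact_squared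
  by (simp add: diffs_inverse_fact_squared)

lemma bessel_series_sums: "(\<lambda>k. z ^ k / (fact k)\<^sup>2) sums bessel_series z"
  unfolding bessel_series_def by (rule summable_sums[OF summable_inverse_fact_squared])

lemma bessel_series'_sums: "(\<lambda>k. z ^ k / (fact (Suc k) * fact k)) sums bessel_series' z"
  unfolding bessel_series'_def by (rule summable_sums[OF summable_bessel_series'])

lemma bessel_I_0_eq: "bessel_I 0 x = bessel_series (x\<^sup>2 / 4)"
  unfolding bessel_I_def bessel_series_def
  by (simp add: power_mult power_divide power2_eq_square)

text \<open>A quarter of the squared Bessel argument is \<open>z\<close>, a polynomial in
  \<open>t\<close> with derivative \<open>rate\<^sup>2 * (p * q) * t / 2\<close>, so the time
  derivative is a plain chain rule.\<close>

lemma edge_density_eq: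
  fixes rate c p q t \<eta> :: real
  assumes c: "0 < c" and pq: "0 \<le> p" "0 \<le> q" and \<eta>: "\<bar>\<eta>\<bar> < c * t"
  defines "z \<equiv> rate\<^sup>2 * (p * q) * ((t + \<eta> / c) / 2 * ((t - \<eta> / c) / 2))"
  shows "edge_density rate c p q \<eta> t = exp (- rate * t) / (4 * c) *
    (rate * (p + q) / 2 * bessel_series z + rate\<^sup>2 * (p * q) * t / 2 * bessel_series' z)"
proof -
  define \<zeta> where "\<zeta> s = rate\<^sup>2 * (p * q) * ((s + \<eta> / c) / 2 * ((s - \<eta> / c) / 2))" for s
  have I: "bessel_I 0 (rate / c * sqrt (p * q) * sqrt (c\<^sup>2 * s\<^sup>2 - \<eta>\<^sup>2)) = bessel_series (\<zeta> s)"
    if "\<bar>\<eta>\<bar> < c * s" for s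
  proof -
    have "\<eta>\<^sup>2 \<le> (c * s)\<^sup>2" using that by (intro abs_le_square_iff[THEN iffD1]) auto
    then have "0 \<le> c\<^sup>2 * s\<^sup>2 - \<eta>\<^sup>2" by (simp add: power_mult_distrib)
    then have "(rate / c * sqrt (p * q) * sqrt (c\<^sup>2 * s\<^sup>2 - \<eta>\<^sup>2))\<^sup>2 / 4
      = (rate / c)\<^sup>2 * (p * q) * (c\<^sup>2 * s\<^sup>2 - \<eta>\<^sup>2) / 4"
      using pq by (simp only: power_mult_distrib real_sqrt_pow2 mult_nonneg_nonneg)
    also have "\<dots> = \<zeta> s"
      using c unfolding \<zeta>_def by (simp add: field_simps power2_eq_square)
    finally show ?thesis unfolding bessel_I_0_eq by simp
  qed
  have "(\<zeta> has_real_derivative rate\<^sup>2 * (p * q) * t / 2) (at t)"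
    unfolding \<zeta>_def using c by (auto intro!: derivative_eq_intros simp: field_simps)
  from DERIV_chain2[OF DERIV_bessel_series this]
  have d: "((\<lambda>s. bessel_series (\<zeta> s)) has_real_derivative bessel_series' (\<zeta> t) * (rate\<^sup>2 * (p * q) * t / 2)) (at t)" .
  \<comment> \<open>The series form holds where \<open>\<bar>\<eta>\<bar> < c * s\<close>; this set
    is open and contains \<open>t\<close>, which suffices for the derivative at
    \<open>t\<close>.\<close>
  have "open {s. \<bar>\<eta>\<bar> < c * s}" by (intro open_Collect_less continuous_intros)
  then have "((\<lambda>s. bessel_I 0 (rate / c * sqrt (p * q) * sqrt (c\<^sup>2 * s\<^sup>2 - \<eta>\<^sup>2))) has_real_derivative
    bessel_series' (\<zeta> t) * (rate\<^sup>2 * (p * q) * t / 2)) (at t)"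
  proof (rule has_field_derivative_transform_within_open[OF d])
    fix s assume "s \<in> {s. \<bar>\<eta>\<bar> < c * s}"
    then show "bessel_series (\<zeta> s) = bessel_I 0 (rate / c * sqrt (p * q) * sqrt (c\<^sup>2 * s\<^sup>2 - \<eta>\<^sup>2))"
      by (intro I[symmetric]) simp
  qed (use \<eta> in simp)
  then have "deriv (\<lambda>s. bessel_I 0 (rate / c * sqrt (p * q) * sqrt (c\<^sup>2 * s\<^sup>2 - \<eta>\<^sup>2))) t
    = bessel_series' (\<zeta> t) * (rate\<^sup>2 * (p * q) * t / 2)"
    by (rule DERIV_imp_deriv)
  then show ?thesis
    unfolding edge_density_def I[OF \<eta>] by (simp add: z_def \<zeta>_def mult.commute)
qed

text \<open>Here \<open>u\<close> and \<open>v\<close> are the times spent along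
  \<open>dir 0\<close> and \<open>dir 1\<close>. The index is the number of events minus one, so
  even \<open>n\<close> yields the Bessel term and odd \<open>n\<close> its derivative. For odd
  \<open>n\<close> the two starting directions contribute \<open>u ^ Suc k * v ^ k\<close> and
  \<open>v ^ Suc k * u ^ k\<close>; their sum has the factor \<open>u + v = t\<close>, the one that
  differentiation produces.\<close>

lemma edge_density_sums:
  fixes rate c p q t \<eta> :: real
  assumes c: "0 < c" and pq: "0 \<le> p" "0 \<le> q" and \<eta>: "\<bar>\<eta>\<bar> < c * t"
  defines "u \<equiv> (t + \<eta> / c) / 2" and "v \<equiv> (t - \<eta> / c) / 2"
  shows "(\<lambda>n. exp (- (rate * t)) * rate ^ Suc n / (8 * c) *
      (p ^ (Suc (Suc n) div 2) * q ^ (Suc n div 2) * (u ^ (Suc n div 2) * v ^ (n div 2)) +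
       q ^ (Suc (Suc n) div 2) * p ^ (Suc n div 2) * (v ^ (Suc n div 2) * u ^ (n div 2))) /
      (fact (Suc n div 2) * fact (n div 2)))
    sums edge_density rate c p q \<eta> t"
proof -
  define z where "z = rate\<^sup>2 * (p * q) * (u * v)"
  define C where "C = exp (- (rate * t)) / (4 * c)"
  have uv: "u + v = t" by (simp add: u_def v_def field_simps)
  have assoc: "a * b / (8 * c) * d / f = a / (8 * c) * (b * d) / f" for a b d f :: real
    by simp
  have even: "(\<lambda>k. C * (rate * (p + q) / 2) * (z ^ k / (fact k)\<^sup>2)) sums (C * (rate * (p + q) / 2) * bessel_series z)"
    by (rule sums_mult[OF bessel_series_sums])
  have odd: "(\<lambda>k. C * (rate\<^sup>2 * (p * q) * t / 2) * (z ^ k / (fact (Suc k) * fact k)))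
      sums (C * (rate\<^sup>2 * (p * q) * t / 2) * bessel_series' z)"
    by (rule sums_mult[OF bessel_series'_sums])
  have "edge_density rate c p q \<eta> t = C * (rate\<^sup>2 * (p * q) * t / 2) * bessel_series' z + C * (rate * (p + q) / 2) * bessel_series z"
    unfolding edge_density_eq[OF c pq \<eta>, of rate, folded u_def v_def, folded z_def] C_def mult_minus_left
    by (simp only: distrib_left mult.assoc add.commute)
  \<comment> \<open>Shaped for \<open>sums_if\<close>: even indices run through one series, odd
    indices through the other.\<close>
  moreover have "(if even n then C * (rate * (p + q) / 2) * (z ^ (n div 2) / (fact (n div 2))\<^sup>2)
      else C * (rate\<^sup>2 * (p * q) * t / 2) * (z ^ ((n - 1) div 2) / (fact (Suc ((n - 1) div 2)) * fact ((n - 1) div 2))))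
    = exp (- (rate * t)) * rate ^ Suc n / (8 * c) *
      (p ^ (Suc (Suc n) div 2) * q ^ (Suc n div 2) * (u ^ (Suc n div 2) * v ^ (n div 2)) +
       q ^ (Suc (Suc n) div 2) * p ^ (Suc n div 2) * (v ^ (Suc n div 2) * u ^ (n div 2))) /
      (fact (Suc n div 2) * fact (n div 2))" for n
  proof (cases "even n")
    case True
    then obtain k where n: "n = 2 * k" by (rule evenE)
    have "rate ^ Suc n * (p ^ Suc k * q ^ k * (u ^ k * v ^ k) + q ^ Suc k * p ^ k * (v ^ k * u ^ k))
      = rate * (p + q) * z ^ k"
      unfolding n z_def power_mult_distrib power_mult[symmetric] by (simp add: algebra_simps)
    moreover have "Suc n div 2 = k" "n div 2 = k" "Suc (Suc n) div 2 = Suc k"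
      unfolding n by auto
    ultimately show ?thesis
      unfolding C_def assoc using True by (simp only: if_True) (simp add: power2_eq_square)
  next
    case False
    then obtain k where n: "n = 2 * k + 1" by (rule oddE)
    have "rate ^ Suc n * (p ^ Suc k * q ^ Suc k * (u ^ Suc k * v ^ k) + q ^ Suc k * p ^ Suc k * (v ^ Suc k * u ^ k))
      = rate\<^sup>2 * (p * q) * (u + v) * z ^ k"
      unfolding n z_def by (simp add: power_mult_distrib power_mult power2_eq_square algebra_simps)
    then have "rate ^ Suc n * (p ^ Suc k * q ^ Suc k * (u ^ Suc k * v ^ k) + q ^ Suc k * p ^ Suc k * (v ^ Suc k * u ^ k))
      = rate\<^sup>2 * (p * q) * t * z ^ k"
      unfolding uv .
    moreover have "Suc n div 2 = Suc k" "n div 2 = k" "Suc (Suc n) div 2 = Suc k" "(n - 1) div 2 = k"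
      unfolding n by auto
    ultimately show ?thesis
      unfolding C_def assoc using False by (simp only: if_False) (simp del: power_Suc fact_Suc)
  qed
  ultimately show ?thesis
    using sums_if[OF odd even] by simp
qed

lemma edge_density_nonneg:
  fixes rate c p q t \<eta> :: real
  assumes "0 < rate" "0 < c" "0 \<le> p" "0 \<le> q" "\<bar>\<eta>\<bar> < c * t"
  shows "0 \<le> edge_density rate c p q \<eta> t"
proof -
  have "0 \<le> t + \<eta> / c" "0 \<le> t - \<eta> / c"
    using assms by (auto simp: field_simps abs_less_iff)
  then show ?thesis
    using assms by (intro sums_le[OF _ sums_zero edge_density_sums])
      (auto intro!: divide_nonneg_nonneg mult_nonneg_nonneg add_nonneg_nonneg)
qed

section \<open>The density on the edge\<close>

context orthogonal_motion
begin

text \<open>The substitution is \<open>x = (t + s * \<eta> / c) / 2\<close> with Jacobian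
  \<open>1 / (2 * c)\<close>; \<open>s\<close> is the sign attached to the starting direction. As
  \<open>A\<close> lies in the open interval, \<open>x\<close> falls in \<open>{0..t}\<close> and
  the first indicator disappears.\<close>

lemma nn_integral_even_time_density_subst:
  fixes c s :: real
  assumes c: "0 < c" and rate: "0 < rate" and A: "A \<in> sets borel" "A \<subseteq> {-(c * t)<..<c * t}" and s: "\<bar>s\<bar> = 1"
  shows "(\<integral>\<^sup>+x. ennreal (indicator {0..t} x * even_time_density t n x) * indicator {x. s * (c * (2 * x - t)) \<in> A} x \<partial>lborel)
    = (\<integral>\<^sup>+\<eta>. ennreal (1 / (2 * c) * even_time_density t n ((t + s * \<eta> / c) / 2)) * indicator A \<eta> \<partial>lborel)"
proof -
  have s2: "s * s = 1" using s by (auto simp: abs_if split: if_splits)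
  have [measurable]: "{x. s * (c * (2 * x - t)) \<in> A} \<in> sets borel"
  proof -
    have "(\<lambda>x. s * (c * (2 * x - t))) \<in> borel_measurable borel" by measurable
    from measurable_sets[OF this A(1)] show ?thesis by (simp add: vimage_def)
  qed
  note [measurable] = A(1)
  have "(\<integral>\<^sup>+x. ennreal (indicator {0..t} x * even_time_density t n x) * indicator {x. s * (c * (2 * x - t)) \<in> A} x \<partial>lborel)
    = \<bar>s / (2 * c)\<bar> * (\<integral>\<^sup>+\<eta>. ennreal (indicator {0..t} (t / 2 + s / (2 * c) * \<eta>) * even_time_density t n (t / 2 + s / (2 * c) * \<eta>))
      * indicator {x. s * (c * (2 * x - t)) \<in> A} (t / 2 + s / (2 * c) * \<eta>) \<partial>lborel)"
    by (rule nn_integral_real_affine) (use c s in auto)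
  also have "\<dots> = (\<integral>\<^sup>+\<eta>. \<bar>s / (2 * c)\<bar> * (ennreal (indicator {0..t} (t / 2 + s / (2 * c) * \<eta>) * even_time_density t n (t / 2 + s / (2 * c) * \<eta>))
      * indicator {x. s * (c * (2 * x - t)) \<in> A} (t / 2 + s / (2 * c) * \<eta>)) \<partial>lborel)"
    by (rule nn_integral_cmult[symmetric]) measurable
  also have "\<dots> = (\<integral>\<^sup>+\<eta>. ennreal (1 / (2 * c) * even_time_density t n ((t + s * \<eta> / c) / 2)) * indicator A \<eta> \<partial>lborel)"
  proof (rule nn_integral_cong)
    fix \<eta> :: real
    define x where "x = (t + s * \<eta> / c) / 2"
    have x: "t / 2 + s / (2 * c) * \<eta> = x" using c by (simp add: x_def field_simps)
    have "s * (c * (2 * x - t)) = s * s * \<eta>" using c by (simp add: x_def field_simps)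
    then have "s * (c * (2 * x - t)) = \<eta>" by (simp add: s2)
    moreover have "x \<in> {0..t}" if "\<eta> \<in> A"
    proof -
      have "\<bar>s * \<eta> / c\<bar> < t"
        using that A(2) c s by (auto simp: abs_mult abs_divide field_simps abs_less_iff)
      moreover have "(t + y) / 2 \<in> {0..t}" if "\<bar>y\<bar> < t" for y
        using that by auto
      ultimately show ?thesis unfolding x_def by blast
    qed
    moreover have "\<bar>s / (2 * c)\<bar> = 1 / (2 * c)" using c s by simp
    ultimately show "ennreal \<bar>s / (2 * c)\<bar> * (ennreal (indicator {0..t} (t / 2 + s / (2 * c) * \<eta>) * even_time_density t n (t / 2 + s / (2 * c) * \<eta>))
        * indicator {x. s * (c * (2 * x - t)) \<in> A} (t / 2 + s / (2 * c) * \<eta>))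
      = ennreal (1 / (2 * c) * even_time_density t n ((t + s * \<eta> / c) / 2)) * indicator A \<eta>"
      unfolding x x_def[symmetric]
      using c rate even_time_density_nonneg[OF rate, of x t n]
      by (cases "\<eta> \<in> A") (auto simp: ennreal_mult[symmetric] simp del: ennreal_mult')
  qed
  finally show ?thesis .
qed

lemma prob_alternating_turns:
  "(\<Prod>k<n. prob {\<omega> \<in> space M. T k \<omega> = (-1) ^ k}) = p ^ (Suc n div 2) * q ^ (n div 2)"
  "(\<Prod>k<n. prob {\<omega> \<in> space M. T k \<omega> = - ((-1) ^ k)}) = q ^ (Suc n div 2) * p ^ (n div 2)"
proof -
  have "prob {\<omega> \<in> space M. T k \<omega> = (-1) ^ k} = (if even k then p else q)"
    "prob {\<omega> \<in> space M. T k \<omega> = - ((-1) ^ k)} = (if even k then q else p)" for k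
    by (simp_all add: T_counterclockwise T_clockwise)
  then show "(\<Prod>k<n. prob {\<omega> \<in> space M. T k \<omega> = (-1) ^ k}) = p ^ (Suc n div 2) * q ^ (n div 2)"
    "(\<Prod>k<n. prob {\<omega> \<in> space M. T k \<omega> = - ((-1) ^ k)}) = q ^ (Suc n div 2) * p ^ (n div 2)"
    by (simp_all add: prod_alternating)
qed

text \<open>Up to a null set the event splits by the number of events and the starting direction.
  Extended nonnegative integrals let the resulting series be summed under the integral without a
  convergence estimate.\<close>

lemma emeasure_edge:
  assumes rate: "0 < rate" and c: "0 < c" and pq: "0 \<le> p" "0 \<le> q" and t: "0 < t"
    and A: "A \<in> sets borel" "A \<subseteq> {-(c * t)<..<c * t}"
  defines "E \<equiv> {\<omega> \<in> space M.
    fst (position c N J T t \<omega>) + snd (position c N J T t \<omega>) = c * t \<and>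
    fst (position c N J T t \<omega>) - snd (position c N J T t \<omega>) \<in> A}"
  shows "E \<in> events"
    and "emeasure M E = (\<integral>\<^sup>+\<eta>. ennreal (edge_density rate c p q \<eta> t) * indicator A \<eta> \<partial>lborel)"
proof -
  have t': "0 \<le> t" using t by simp
  have "(\<lambda>\<omega>. fst (position c N J T t \<omega>) + snd (position c N J T t \<omega>)) -` {c * t} \<inter> space M \<inter>
    ((\<lambda>\<omega>. fst (position c N J T t \<omega>) - snd (position c N J T t \<omega>)) -` A \<inter> space M) \<in> events"
    by (intro sets.Int measurable_sets[OF borel_measurable_position(1)]
        measurable_sets[OF borel_measurable_position(2)] A(1)) simp
  then show E: "E \<in> events"
    by (rule back_subst[where P="\<lambda>S. S \<in> events"]) (auto simp: E_def)
  define B where "B s = {x. s * (c * (2 * x - t)) \<in> A}" for s :: real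
  have B: "B s \<in> sets borel" for s
  proof -
    have "(\<lambda>x. s * (c * (2 * x - t))) \<in> borel_measurable borel" by measurable
    from measurable_sets[OF this A(1)] show ?thesis by (simp add: B_def vimage_def)
  qed
  define S where "S n j s \<sigma> = {\<omega> \<in> space M. N t \<omega> = Suc n \<and> even_time N t \<omega> \<in> B s \<and> J \<omega> = j \<and> (\<forall>k<Suc n. T k \<omega> = \<sigma> k)}"
    for n :: nat and j :: int and s :: real and \<sigma> :: "nat \<Rightarrow> int"
  have S: "S n j s \<sigma> \<in> events" for n j s \<sigma>
    unfolding S_def by (rule emeasure_N_turns(1)[OF t' B])
  let ?S0 = "\<lambda>n. S n 0 1 (\<lambda>k. (-1) ^ k)" and ?S1 = "\<lambda>n. S n 1 (-1) (\<lambda>k. - ((-1) ^ k))"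
  \<comment> \<open>The contribution of \<open>Suc n\<close> events: \<open>8 * c\<close> combines
    the Jacobian \<open>1 / (2 * c)\<close> with the probability \<open>1 / 4\<close> of each
    starting direction, and the two summands belong to the starts \<open>dir 0\<close> and
    \<open>dir 1\<close>.\<close>
  define f where "f n \<eta> = exp (- (rate * t)) * rate ^ Suc n / (8 * c) *
      (p ^ (Suc (Suc n) div 2) * q ^ (Suc n div 2) * (((t + \<eta> / c) / 2) ^ (Suc n div 2) * ((t - \<eta> / c) / 2) ^ (n div 2)) +
       q ^ (Suc (Suc n) div 2) * p ^ (Suc n div 2) * (((t - \<eta> / c) / 2) ^ (Suc n div 2) * ((t + \<eta> / c) / 2) ^ (n div 2))) /
      (fact (Suc n div 2) * fact (n div 2))" for n \<eta>
  have dens: "even_time_density t n ((t + s * \<eta> / c) / 2) = exp (- (rate * t)) * rate ^ Suc n *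
     (((t + s * \<eta> / c) / 2) ^ (Suc n div 2) * ((t - s * \<eta> / c) / 2) ^ (n div 2)) / (fact (Suc n div 2) * fact (n div 2))"
    for n s \<eta>
  proof -
    have "t - (t + s * \<eta> / c) / 2 = (t - s * \<eta> / c) / 2" by (simp add: field_simps)
    then show ?thesis by (simp only: even_time_density_def)
  qed
  have uv: "0 \<le> (t + \<eta> / c) / 2" "0 \<le> (t - \<eta> / c) / 2" if "\<eta> \<in> A" for \<eta>
    using that A(2) c by (auto simp: field_simps)
  have f_nonneg: "0 \<le> f n \<eta>" if "\<eta> \<in> A" for n \<eta>
  proof -
    have "0 \<le> exp (- (rate * t)) * rate ^ Suc n / (8 * c) *
      (p ^ (Suc (Suc n) div 2) * q ^ (Suc n div 2) * (u ^ (Suc n div 2) * v ^ (n div 2)) +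
       q ^ (Suc (Suc n) div 2) * p ^ (Suc n div 2) * (v ^ (Suc n div 2) * u ^ (n div 2))) /
      (fact (Suc n div 2) * fact (n div 2))" if "0 \<le> u" "0 \<le> v" for u v :: real
      using that rate c pq
      by (intro divide_nonneg_nonneg mult_nonneg_nonneg add_nonneg_nonneg zero_le_power) auto
    from this[OF uv[OF that]] show ?thesis unfolding f_def .
  qed
  note [measurable] = A(1)
  have f_meas [measurable]: "f n \<in> borel_measurable borel" for n
    unfolding f_def[abs_def] by measurable
  have f_sums: "(\<lambda>n. f n \<eta>) sums edge_density rate c p q \<eta> t" if "\<eta> \<in> A" for \<eta>
    unfolding f_def using that A(2) by (intro edge_density_sums[OF c pq]) (auto simp: abs_less_iff)
  have emeasure_S: "emeasure M (S n j s \<sigma>) = (\<integral>\<^sup>+\<eta>. ennreal (1 / (2 * c) * even_time_density t n ((t + s * \<eta> / c) / 2)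
      * (1 / 4 * (\<Prod>k<Suc n. prob {\<omega> \<in> space M. T k \<omega> = \<sigma> k}))) * indicator A \<eta> \<partial>lborel)"
    if s: "\<bar>s\<bar> = 1" and j: "j \<in> {0..3}" for n j s \<sigma>
  proof -
    let ?P = "1 / 4 * (\<Prod>k<Suc n. prob {\<omega> \<in> space M. T k \<omega> = \<sigma> k})"
    have P: "0 \<le> ?P" by (simp add: prod_nonneg del: prod.lessThan_Suc)
    have [measurable]: "(\<lambda>\<eta>. even_time_density t n ((t + s * \<eta> / c) / 2)) \<in> borel_measurable borel"
      by (rule measurable_compose[OF _ borel_measurable_even_time_density]) measurable
    have "emeasure M (S n j s \<sigma>) = (\<integral>\<^sup>+x. ennreal (indicator {0..t} x * even_time_density t n x) * indicator (B s) x \<partial>lborel) * ennreal ?P"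
      unfolding S_def emeasure_N_turns(2)[OF t' B] emeasure_even_time[OF rate t B] J_uniform[OF j] by simp
    also have "\<dots> = (\<integral>\<^sup>+\<eta>. ennreal (1 / (2 * c) * even_time_density t n ((t + s * \<eta> / c) / 2)) * indicator A \<eta> \<partial>lborel) * ennreal ?P"
      unfolding B_def by (simp only: nn_integral_even_time_density_subst[OF c rate A s])
    also have "\<dots> = (\<integral>\<^sup>+\<eta>. ennreal (1 / (2 * c) * even_time_density t n ((t + s * \<eta> / c) / 2)) * indicator A \<eta> * ennreal ?P \<partial>lborel)"
      by (intro nn_integral_multc[symmetric]) measurable
    also have "\<dots> = (\<integral>\<^sup>+\<eta>. ennreal (1 / (2 * c) * even_time_density t n ((t + s * \<eta> / c) / 2) * ?P) * indicator A \<eta> \<partial>lborel)"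
    proof (rule nn_integral_cong)
      fix \<eta> :: real
      show "ennreal (1 / (2 * c) * even_time_density t n ((t + s * \<eta> / c) / 2)) * indicator A \<eta> * ennreal ?P
        = ennreal (1 / (2 * c) * even_time_density t n ((t + s * \<eta> / c) / 2) * ?P) * indicator A \<eta>"
        by (subst ennreal_mult''[OF P]) (simp only: mult_ac)
    qed
    finally show ?thesis .
  qed
  have S_un: "emeasure M (?S0 n \<union> ?S1 n) = (\<integral>\<^sup>+\<eta>. ennreal (f n \<eta>) * indicator A \<eta> \<partial>lborel)" for n
  proof -
    let ?g0 = "\<lambda>\<eta>. 1 / (2 * c) * even_time_density t n ((t + 1 * \<eta> / c) / 2) * (1 / 4 * (p ^ (Suc (Suc n) div 2) * q ^ (Suc n div 2)))"
    let ?g1 = "\<lambda>\<eta>. 1 / (2 * c) * even_time_density t n ((t + (-1) * \<eta> / c) / 2) * (1 / 4 * (q ^ (Suc (Suc n) div 2) * p ^ (Suc n div 2)))"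
    have [measurable]: "?g0 \<in> borel_measurable borel" "?g1 \<in> borel_measurable borel"
      unfolding dens by measurable
    have "?S0 n \<inter> ?S1 n = {}" by (auto simp: S_def)
    then have "emeasure M (?S0 n \<union> ?S1 n) = emeasure M (?S0 n) + emeasure M (?S1 n)"
      using S by (intro plus_emeasure[symmetric]) auto
    also have "emeasure M (?S0 n) = (\<integral>\<^sup>+\<eta>. ennreal (?g0 \<eta>) * indicator A \<eta> \<partial>lborel)"
      by (subst emeasure_S) (simp_all only: prob_alternating_turns, simp_all)
    also have "emeasure M (?S1 n) = (\<integral>\<^sup>+\<eta>. ennreal (?g1 \<eta>) * indicator A \<eta> \<partial>lborel)"
      by (subst emeasure_S) (simp_all only: prob_alternating_turns, simp_all)
    also have "(\<integral>\<^sup>+\<eta>. ennreal (?g0 \<eta>) * indicator A \<eta> \<partial>lborel) + (\<integral>\<^sup>+\<eta>. ennreal (?g1 \<eta>) * indicator A \<eta> \<partial>lborel)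
      = (\<integral>\<^sup>+\<eta>. ennreal (?g0 \<eta>) * indicator A \<eta> + ennreal (?g1 \<eta>) * indicator A \<eta> \<partial>lborel)"
      by (intro nn_integral_add[symmetric]) measurable
    also have "\<dots> = (\<integral>\<^sup>+\<eta>. ennreal (f n \<eta>) * indicator A \<eta> \<partial>lborel)"
    proof (rule nn_integral_cong)
      fix \<eta> :: real
      show "ennreal (?g0 \<eta>) * indicator A \<eta> + ennreal (?g1 \<eta>) * indicator A \<eta> = ennreal (f n \<eta>) * indicator A \<eta>"
      proof (cases "\<eta> \<in> A")
        case True
        have g: "0 \<le> ?g0 \<eta>" "0 \<le> ?g1 \<eta>"
          unfolding dens using uv[OF True] rate c pq
          by (auto intro!: divide_nonneg_nonneg mult_nonneg_nonneg)
        have "?g0 \<eta> + ?g1 \<eta> = f n \<eta>"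
          unfolding dens f_def by (simp add: add_divide_distrib distrib_left mult_ac del: power_Suc fact_Suc)
        then show ?thesis using True ennreal_plus[OF g] by simp
      qed simp
    qed
    finally show ?thesis .
  qed
  have "emeasure M E = emeasure M (\<Union>n. ?S0 n \<union> ?S1 n)"
  proof (rule emeasure_eq_AE)
    show "(\<Union>n. ?S0 n \<union> ?S1 n) \<in> events" using S by auto
    show "AE \<omega> in M. \<omega> \<in> E \<longleftrightarrow> \<omega> \<in> (\<Union>n. ?S0 n \<union> ?S1 n)"
      using AE_edge_iff[OF rate t c, of A] AE_space
    proof eventually_elim
      case (elim \<omega>)
      note \<omega> = \<open>\<omega> \<in> space M\<close>
      \<comment> \<open>Without events the even time is \<open>t\<close>, and the difference of the
        coordinates would be an end point, outside \<open>A\<close>. Hence the union may start at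
        one event.\<close>
      have pos: "N t \<omega> \<noteq> 0" if "c * (2 * even_time N t \<omega> - t) \<in> A \<or> - (c * (2 * even_time N t \<omega> - t)) \<in> A"
      proof
        assume "N t \<omega> = 0"
        then have "N u \<omega> = 0" if "u \<in> {0..t}" for u
          using N_mono[OF \<omega>, of u t] that by auto
        then have "even_time N t \<omega> = integral {0..t} (\<lambda>_. 1)"
          unfolding even_time_def by (intro integral_cong) auto
        then have "2 * even_time N t \<omega> - t = t" using t by simp
        with that A(2) show False by auto
      qed
      show ?case
        using elim(1) \<omega> pos
        by (cases "N t \<omega>") (auto simp: E_def S_def B_def)
    qed
  qed (fact E)
  also have "\<dots> = (\<Sum>n. emeasure M (?S0 n \<union> ?S1 n))"
  proof (rule suminf_emeasure[symmetric])
    show "range (\<lambda>n. ?S0 n \<union> ?S1 n) \<subseteq> events" using S by auto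
    show "disjoint_family (\<lambda>n. ?S0 n \<union> ?S1 n)" by (auto simp: disjoint_family_on_def S_def)
  qed
  also have "\<dots> = (\<Sum>n. \<integral>\<^sup>+\<eta>. ennreal (f n \<eta>) * indicator A \<eta> \<partial>lborel)"
    by (simp only: S_un)
  also have "\<dots> = (\<integral>\<^sup>+\<eta>. (\<Sum>n. ennreal (f n \<eta>) * indicator A \<eta>) \<partial>lborel)"
    by (intro nn_integral_suminf[symmetric]) measurable
  also have "\<dots> = (\<integral>\<^sup>+\<eta>. ennreal (edge_density rate c p q \<eta> t) * indicator A \<eta> \<partial>lborel)"
  proof (rule nn_integral_cong)
    fix \<eta> :: real
    show "(\<Sum>n. ennreal (f n \<eta>) * indicator A \<eta>) = ennreal (edge_density rate c p q \<eta> t) * indicator A \<eta>"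
    proof (cases "\<eta> \<in> A")
      case True
      then show ?thesis
        using suminf_ennreal_eq[OF f_nonneg[OF True] f_sums[OF True]] by simp
    qed simp
  qed
  finally show "emeasure M E = (\<integral>\<^sup>+\<eta>. ennreal (edge_density rate c p q \<eta> t) * indicator A \<eta> \<partial>lborel)" .
qed

end

text \<open>The definition contains \<open>deriv\<close>, so measurability is read off from the
  series form, established for \<open>\<bar>\<eta>\<bar> < c * t\<close>; the indicator restricts to
  that range.\<close>

lemma borel_measurable_edge_density:
  assumes "0 < c" "0 \<le> p" "0 \<le> q"
  shows "(\<lambda>\<eta>. indicator {-(c * t)<..<c * t} \<eta> * edge_density rate c p q \<eta> t) \<in> borel_measurable borel"
proof -
  have "isCont bessel_series z" "isCont bessel_series' z" for z
  proof -
    show "isCont bessel_series z" by (rule DERIV_isCont[OF DERIV_bessel_series])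
    have "isCont (\<lambda>z. \<Sum>k. 1 / (fact (Suc k) * fact k) * z ^ k :: real) z"
      using isCont_powser_converges_everywhere[of "\<lambda>k. 1 / (fact (Suc k) * fact k) :: real"] summable_bessel_series'
      by simp
    then show "isCont bessel_series' z" by (simp add: bessel_series'_def[abs_def])
  qed
  then have [measurable]: "bessel_series \<in> borel_measurable borel" "bessel_series' \<in> borel_measurable borel"
    by (auto intro!: borel_measurable_continuous_onI continuous_at_imp_continuous_on)
  have "(\<lambda>\<eta>. indicator {-(c * t)<..<c * t} \<eta> * (exp (- rate * t) / (4 * c) *
    (rate * (p + q) / 2 * bessel_series (rate\<^sup>2 * (p * q) * ((t + \<eta> / c) / 2 * ((t - \<eta> / c) / 2)))
      + rate\<^sup>2 * (p * q) * t / 2 * bessel_series' (rate\<^sup>2 * (p * q) * ((t + \<eta> / c) / 2 * ((t - \<eta> / c) / 2))))))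
    \<in> borel_measurable borel"
    by measurable
  then show ?thesis
    by (rule measurable_cong[THEN iffD1, rotated])
       (use edge_density_eq[OF assms] in \<open>simp add: indicator_def abs_less_iff\<close>)
qed

text \<open>Integrability is asserted alongside the formula because the Lebesgue integral of a
  non-integrable function is 0 by convention; with it and nonnegativity the integral is that of a
  genuine density.\<close>

theorem theorem2:
  fixes M :: "'a measure" and rate c p q t :: real
    and N :: "real \<Rightarrow> 'a \<Rightarrow> nat" and J :: "'a \<Rightarrow> int" and T :: "nat \<Rightarrow> 'a \<Rightarrow> int"
    and X Y :: "real \<Rightarrow> 'a \<Rightarrow> real"
  defines "X \<equiv> \<lambda>s \<omega>. fst (position c N J T s \<omega>)"
    and "Y \<equiv> \<lambda>s \<omega>. snd (position c N J T s \<omega>)"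
  assumes "0 < rate" and "0 < c" and "0 \<le> p" and "0 \<le> q" and "p + q \<le> 1"
    and "orthogonal_motion M rate N p q J T"
    and "0 < t"
  shows "set_integrable lborel {-(c * t)<..<c * t} (\<lambda>\<eta>. edge_density rate c p q \<eta> t)
    \<and> (\<forall>\<eta>. \<bar>\<eta>\<bar> < c * t \<longrightarrow> 0 \<le> edge_density rate c p q \<eta> t)
    \<and> (\<forall>A \<in> sets borel. A \<subseteq> {-(c * t)<..<c * t} \<longrightarrow>
         {\<omega> \<in> space M. X t \<omega> + Y t \<omega> = c * t \<and> X t \<omega> - Y t \<omega> \<in> A} \<in> sets M \<and>
         measure M {\<omega> \<in> space M. X t \<omega> + Y t \<omega> = c * t \<and> X t \<omega> - Y t \<omega> \<in> A}
           = (LINT \<eta>:A|lborel. edge_density rate c p q \<eta> t))"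
proof -
  interpret orthogonal_motion M rate N p q J T by fact
  note assms = \<open>0 < rate\<close> \<open>0 < c\<close> \<open>0 \<le> p\<close> \<open>0 \<le> q\<close> \<open>0 < t\<close>
  let ?I = "{-(c * t)<..<c * t}"
  let ?f = "\<lambda>\<eta>. edge_density rate c p q \<eta> t"
  have nonneg: "0 \<le> ?f \<eta>" if "\<bar>\<eta>\<bar> < c * t" for \<eta>
    using assms that by (intro edge_density_nonneg)
  have meas: "(\<lambda>\<eta>. indicator ?I \<eta> * ?f \<eta>) \<in> borel_measurable borel"
    using assms by (intro borel_measurable_edge_density)
  have nonneg_I: "0 \<le> indicator A \<eta> * ?f \<eta>" if "A \<subseteq> ?I" for A \<eta>
    using that nonneg[of \<eta>] by (auto simp: indicator_def abs_less_iff)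
  have eq: "ennreal (?f \<eta>) * indicator A \<eta> = ennreal (indicator A \<eta> * ?f \<eta>)" for A \<eta>
    by (auto simp: indicator_def)
  \<comment> \<open>Integrability takes no estimate: over the whole interval the integral is the
    probability of an event, hence finite.\<close>
  have "(\<integral>\<^sup>+\<eta>. ennreal (indicator ?I \<eta> * ?f \<eta>) \<partial>lborel) \<noteq> \<infinity>"
    using emeasure_edge(2)[OF assms(1,2,3,4,5), of ?I] unfolding eq
    by (metis borel_open emeasure_eq_measure ennreal_neq_top infinity_ennreal_def open_greaterThanLessThan order_refl)
  then have "integrable lborel (\<lambda>\<eta>. indicator ?I \<eta> * ?f \<eta>)"
    using meas nonneg_I by (intro integrableI_nonneg) (auto simp: top.not_eq_extremum)
  then have int: "set_integrable lborel ?I ?f"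
    by (simp add: set_integrable_def)
  have "{\<omega> \<in> space M. X t \<omega> + Y t \<omega> = c * t \<and> X t \<omega> - Y t \<omega> \<in> A} \<in> sets M \<and>
         measure M {\<omega> \<in> space M. X t \<omega> + Y t \<omega> = c * t \<and> X t \<omega> - Y t \<omega> \<in> A}
           = (LINT \<eta>:A|lborel. ?f \<eta>)" (is "?E \<in> _ \<and> _") if A: "A \<in> sets borel" "A \<subseteq> ?I" for A
  proof
    show "?E \<in> sets M"
      unfolding X_def Y_def by (rule emeasure_edge(1)[OF assms A])
    have "set_integrable lborel A ?f"
      using set_integrable_subset[OF int] A by simp
    then have "ennreal (LINT \<eta>:A|lborel. ?f \<eta>) = (\<integral>\<^sup>+\<eta>. ennreal (indicator A \<eta> * ?f \<eta>) \<partial>lborel)"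
      unfolding set_integrable_def set_lebesgue_integral_def
      by (subst nn_integral_eq_integral) (use nonneg_I[OF A(2)] in auto)
    also have "\<dots> = emeasure M ?E"
      unfolding X_def Y_def emeasure_edge(2)[OF assms A] eq ..
    finally have "ennreal (measure M ?E) = ennreal (LINT \<eta>:A|lborel. ?f \<eta>)"
      by (simp add: emeasure_eq_measure)
    moreover have "0 \<le> (LINT \<eta>:A|lborel. ?f \<eta>)"
      unfolding set_lebesgue_integral_def using nonneg_I[OF A(2)] by (intro integral_nonneg_AE) auto
    ultimately show "measure M ?E = (LINT \<eta>:A|lborel. ?f \<eta>)" by simp
  qed
  with int nonneg show ?thesis by blast
qed

end
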